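(* If $\mathcal{N}$ is a singular maximal abelian von Neumann subalgebra (MASA) of a von Neumann algebra $\mathcal{M}$, then $\mathcal{N}$ is completely singular in $\mathcal{M}$.
   Context: $\bar\otimes$ denotes the von Neumann algebra tensor product, and von Neumann subalgebras contain the identity of the ambient algebra. A von Neumann subalgebra $\mathcal{N}$ of a von Neumann algebra $\mathcal{M}$ is singular in $\mathcal{M}$ if every unitary $U\in\mathcal{M}$ with $U\mathcal{N}U^*=\mathcal{N}$ belongs to $\mathcal{N}$. $\mathcal{N}$ is completely singular in $\mathcal{M}$ if $\mathcal{N}\bar\otimes\mathcal{B}(\mathcal{K})$ is singular in $\mathcal{M}\bar\otimes\mathcal{B}(\mathcal{K})$ for every Hilbert space $\mathcal{K}$. *)

theory Defs
  imports "HOL-Analysis.Analysis"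
begin

section \<open>Complex Hilbert spaces\<close>

text \<open>
  The complex inner product is antilinear in its first and linear in its second argument.
  The real inner product of the class \<^class>\<open>real_inner\<close> is its real part, so that norm, metric
  and topology are those of the library. The space is not assumed to be separable or nonzero.
\<close>

class chilbert_space = real_inner + complete_space +
  fixes scaleC :: "complex \<Rightarrow> 'a \<Rightarrow> 'a"  (infixr "*\<^sub>C" 75)
    and cinner :: "'a \<Rightarrow> 'a \<Rightarrow> complex"
  assumes scaleC_add_right: "a *\<^sub>C (x + y) = a *\<^sub>C x + a *\<^sub>C y"
    and scaleC_add_left: "(a + b) *\<^sub>C x = a *\<^sub>C x + b *\<^sub>C x"
    and scaleC_scaleC: "a *\<^sub>C b *\<^sub>C x = (a * b) *\<^sub>C x"
    and scaleC_of_real: "complex_of_real r *\<^sub>C x = r *\<^sub>R x"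
    and cinner_commute: "cinner x y = cnj (cinner y x)"
    and cinner_add_right: "cinner x (y + z) = cinner x y + cinner x z"
    and cinner_scaleC_right: "cinner x (a *\<^sub>C y) = a * cinner x y"
    and inner_eq_Re_cinner: "inner x y = Re (cinner x y)"

subclass (in chilbert_space) banach ..

lemma cinner_add_left: "cinner (x + y) z = cinner x z + cinner y (z :: 'a::chilbert_space)"
  by (metis cinner_commute cinner_add_right complex_cnj_add)

lemma cinner_scaleC_left: "cinner (a *\<^sub>C x) y = cnj a * cinner x (y :: 'a::chilbert_space)"
  by (metis cinner_commute cinner_scaleC_right complex_cnj_mult)

lemma scaleC_one [simp]: "1 *\<^sub>C x = (x :: 'a::chilbert_space)"
  using scaleC_of_real[of 1 x] by simp

lemma scaleC_zero_left [simp]: "0 *\<^sub>C x = (0 :: 'a::chilbert_space)"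
  using scaleC_of_real[of 0 x] by simp

lemma scaleC_zero_right [simp]: "a *\<^sub>C 0 = (0 :: 'a::chilbert_space)"
  using scaleC_add_right[of a 0 "0 :: 'a"] by simp

lemma cinner_scaleR_right:
  "cinner x (r *\<^sub>R y) = complex_of_real r * cinner x (y :: 'a::chilbert_space)"
  by (metis cinner_scaleC_right scaleC_of_real)

lemma cinner_scaleR_left:
  "cinner (r *\<^sub>R x) y = complex_of_real r * cinner x (y :: 'a::chilbert_space)"
  by (metis cinner_scaleC_left scaleC_of_real complex_cnj_complex_of_real)

lemma cinner_zero_right [simp]: "cinner x (0 :: 'a::chilbert_space) = 0"
  using cinner_add_right[of x 0 0] by simp

lemma cinner_zero_left [simp]: "cinner (0 :: 'a::chilbert_space) x = 0"
  using cinner_add_left[of 0 0 x] by simp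

lemma cinner_diff_right: "cinner x (y - z) = cinner x y - cinner x (z :: 'a::chilbert_space)"
  using cinner_add_right[of x "y - z" z] by simp

lemma cinner_diff_left: "cinner (x - y) z = cinner x z - cinner y (z :: 'a::chilbert_space)"
  using cinner_add_left[of "x - y" y z] by simp

lemma cinner_sum_right: "cinner x (sum f A) = (\<Sum>i\<in>A. cinner x (f i :: 'a::chilbert_space))"
  by (induction A rule: infinite_finite_induct) (simp_all add: cinner_add_right)

lemma cinner_sum_left: "cinner (sum f A) x = (\<Sum>i\<in>A. cinner (f i) (x :: 'a::chilbert_space))"
  by (induction A rule: infinite_finite_induct) (simp_all add: cinner_add_left)

lemma cinner_self: "cinner x x = complex_of_real ((norm (x :: 'a::chilbert_space))\<^sup>2)"
proof -
  have "Im (cinner x x) = 0"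
    using arg_cong[OF cinner_commute[of x x], of Im] by simp
  moreover have "Re (cinner x x) = (norm x)\<^sup>2"
    by (simp add: power2_norm_eq_inner inner_eq_Re_cinner)
  ultimately show ?thesis by (simp add: complex_eq_iff)
qed

lemma norm_scaleC: "norm (a *\<^sub>C x) = cmod a * norm (x :: 'a::chilbert_space)"
proof -
  have "(norm (a *\<^sub>C x))\<^sup>2 = Re ((cnj a * a) * cinner x x)"
    by (simp add: power2_norm_eq_inner inner_eq_Re_cinner cinner_scaleC_left cinner_scaleC_right
      mult.assoc mult.left_commute[of a] del: times_complex.sel)
  also have "\<dots> = Re (complex_of_real ((cmod a)\<^sup>2 * (norm x)\<^sup>2))"
    by (simp only: cinner_self of_real_mult complex_norm_square mult.commute[of "cnj a"])
  finally show ?thesis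
    by (simp add: power2_eq_iff_nonneg flip: power_mult_distrib)
qed

lemma norm_cinner_le: "cmod (cinner x y) \<le> norm x * norm (y :: 'a::chilbert_space)"
proof (cases "cinner x y = 0")
  case False
  define a where "a = cnj (cinner x y) / complex_of_real (cmod (cinner x y))"
  have a: "cmod a = 1" using False by (simp add: a_def norm_divide)
  have "a * cinner x y = complex_of_real (cmod (cinner x y))"
    using False complex_norm_square[of "cinner x y"]
    by (simp add: a_def power2_eq_square mult.commute[of "cnj _"] divide_eq_eq)
  then have "cmod (cinner x y) = inner x (a *\<^sub>C y)"
    by (simp add: inner_eq_Re_cinner cinner_scaleC_right del: times_complex.sel)
  also have "\<dots> \<le> norm x * norm (a *\<^sub>C y)" by (rule norm_cauchy_schwarz)
  finally show ?thesis by (simp add: norm_scaleC a)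
qed simp

lemma bounded_linear_cinner_right: "bounded_linear (cinner (x :: 'a::chilbert_space))"
proof (rule bounded_linear_intro[of _ "norm x"])
  show "cmod (cinner x y) \<le> norm y * norm x" for y
    using norm_cinner_le[of x y] by (simp only: mult.commute)
qed (simp_all add: cinner_add_right cinner_scaleR_right scaleR_conv_of_real)

lemma bounded_linear_cinner_left: "bounded_linear (\<lambda>x. cinner x (y :: 'a::chilbert_space))"
  by (rule bounded_linear_intro[of _ "norm y"])
    (simp_all add: cinner_add_left cinner_scaleR_left scaleR_conv_of_real norm_cinner_le)

lemma bounded_linear_scaleC_right: "bounded_linear (\<lambda>x :: 'a::chilbert_space. a *\<^sub>C x)"
proof (rule bounded_linear_intro[of _ "cmod a"])
  show "a *\<^sub>C r *\<^sub>R x = r *\<^sub>R a *\<^sub>C x" for r and x :: 'a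
    by (simp add: scaleC_scaleC mult.commute flip: scaleC_of_real)
qed (simp_all add: scaleC_add_right norm_scaleC mult.commute)


section \<open>Orthonormal bases\<close>

definition is_onb :: "'a::chilbert_space set \<Rightarrow> bool" where
  "is_onb B \<longleftrightarrow> (\<forall>x\<in>B. \<forall>y\<in>B. cinner x y = (if x = y then 1 else 0)) \<and>
    (\<forall>x. (\<forall>b\<in>B. cinner b x = 0) \<longrightarrow> x = 0)"

definition onb :: "'a::chilbert_space set" where
  "onb = (SOME B. is_onb B)"

lemma is_onb_onb: "is_onb (onb :: 'a::chilbert_space set)"
proof -
  define ON where "ON = {B :: 'a set. \<forall>x\<in>B. \<forall>y\<in>B. cinner x y = (if x = y then 1 else 0)}"
  have "\<exists>M\<in>ON. \<forall>X\<in>ON. M \<subseteq> X \<longrightarrow> X = M"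
  proof (rule subset_Zorn')
    fix C assume C: "subset.chain ON C"
    have "cinner x y = (if x = y then 1 else 0)" if xy: "x \<in> \<Union>C" "y \<in> \<Union>C" for x y
    proof -
      from xy obtain X Y where XY: "X \<in> C" "x \<in> X" "Y \<in> C" "y \<in> Y" by blast
      with C have "X \<subseteq> Y \<or> Y \<subseteq> X" unfolding subset.chain_def by blast
      then obtain Z where Z: "Z \<in> C" "x \<in> Z" "y \<in> Z" using XY by blast
      then have "Z \<in> ON" using C unfolding subset.chain_def by blast
      with Z(2,3) show ?thesis by (simp add: ON_def)
    qed
    then show "\<Union>C \<in> ON" unfolding ON_def by (intro CollectI ballI)
  qed
  then obtain B where B: "B \<in> ON" and max: "\<forall>X\<in>ON. B \<subseteq> X \<longrightarrow> X = B"
    by (rule bexE)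
  have compl: "x = 0" if orth: "\<forall>b\<in>B. cinner b x = 0" for x
  proof (rule ccontr)
    assume "x \<noteq> 0"
    define u where "u = (1 / norm x) *\<^sub>R x"
    have u1: "cinner u u = 1"
      using \<open>x \<noteq> 0\<close> by (simp add: cinner_self u_def)
    have bu: "cinner b u = 0" if "b \<in> B" for b
      using orth that by (simp add: u_def cinner_scaleR_right)
    have ub: "cinner u b = 0" if "b \<in> B" for b
      by (subst cinner_commute) (simp add: bu[OF that])
    have "u \<notin> B" using bu[of u] u1 by auto
    have "insert u B \<in> ON"
      using B u1 bu ub \<open>u \<notin> B\<close> by (auto simp: ON_def)
    from bspec[OF max this] \<open>u \<notin> B\<close> show False by blast
  qed
  have "is_onb B" unfolding is_onb_def
    by (intro conjI allI impI compl) (use B in \<open>simp_all add: ON_def\<close>)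
  then show ?thesis unfolding onb_def by (rule someI)
qed

lemma onb_cinner:
  fixes x y :: "'a::chilbert_space"
  assumes "x \<in> onb" "y \<in> onb"
  shows "cinner x y = (if x = y then 1 else 0)"
  using is_onb_onb[where 'a='a] assms unfolding is_onb_def by simp

lemma onb_complete:
  fixes x :: "'a::chilbert_space"
  assumes "\<And>b. b \<in> onb \<Longrightarrow> cinner b x = 0"
  shows "x = 0"
  using conjunct2[OF is_onb_onb[where 'a='a, unfolded is_onb_def]] assms by blast

lemma norm_onb_sum:
  assumes "finite F" "F \<subseteq> onb"
  shows "(norm (\<Sum>e\<in>F. c e *\<^sub>C e))\<^sup>2 = (\<Sum>e\<in>F. (cmod (c e))\<^sup>2)"
proof -
  have "complex_of_real ((norm (\<Sum>e\<in>F. c e *\<^sub>C e))\<^sup>2)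
      = (\<Sum>e\<in>F. cnj (c e) * (\<Sum>d\<in>F. c d * cinner e d))"
    unfolding cinner_self[symmetric] cinner_sum_left
    by (simp add: cinner_sum_right cinner_scaleC_left cinner_scaleC_right sum_distrib_left mult_ac)
  also have "\<dots> = (\<Sum>e\<in>F. cnj (c e) * (\<Sum>d\<in>F. if e = d then c d else 0))"
    using assms by (intro sum.cong refl arg_cong2[of _ _ _ _ "(*)"]) (auto simp: onb_cinner subset_iff)
  also have "\<dots> = (\<Sum>e\<in>F. complex_of_real ((cmod (c e))\<^sup>2))"
    using assms by (intro sum.cong refl) (simp add: complex_norm_square mult.commute del: of_real_power)
  also have "\<dots> = complex_of_real (\<Sum>e\<in>F. (cmod (c e))\<^sup>2)"
    by (simp del: of_real_power)
  finally show ?thesis by (simp only: of_real_eq_iff)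
qed

lemma onb_bessel_finite:
  assumes "finite F" "F \<subseteq> onb"
  shows "(\<Sum>e\<in>F. (cmod (cinner e x))\<^sup>2) \<le> (norm x)\<^sup>2"
proof -
  let ?s = "\<Sum>e\<in>F. cinner e x *\<^sub>C e"
  let ?S = "\<Sum>e\<in>F. (cmod (cinner e x))\<^sup>2"
  have "cinner ?s x = complex_of_real ?S"
    by (simp add: cinner_sum_left cinner_scaleC_left complex_norm_square mult.commute
      del: of_real_power)
  then have "?S = inner ?s x" by (simp add: inner_eq_Re_cinner)
  moreover have "(norm ?s)\<^sup>2 = ?S" by (rule norm_onb_sum[OF assms])
  moreover have "0 \<le> (norm (x - ?s))\<^sup>2" by simp
  ultimately show ?thesis
    by (simp add: power2_norm_eq_inner inner_diff_left inner_diff_right inner_commute)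
qed

lemma onb_bessel: "(\<lambda>e. (cmod (cinner e x))\<^sup>2) summable_on onb"
  by (rule nonneg_bdd_above_summable_on)
    (auto intro!: bdd_aboveI2[where M="(norm x)\<^sup>2"] onb_bessel_finite)

lemma onb_summable:
  fixes c :: "'a::chilbert_space \<Rightarrow> complex"
  assumes c: "(\<lambda>e. (cmod (c e))\<^sup>2) summable_on onb"
  shows "(\<lambda>e. c e *\<^sub>C e) summable_on onb"
proof -
  let ?G = "\<lambda>F. \<Sum>e\<in>F. c e *\<^sub>C (e::'a)"
  let ?g = "\<lambda>e. (cmod (c e))\<^sup>2"
  define l where "l = infsum ?g (onb::'a set)"
  have hs: "(?g has_sum l) (onb::'a set)" using c by (simp add: l_def)
  have ap: "\<exists>F. finite F \<and> F \<subseteq> (onb::'a set) \<and> l - e < sum ?g F" if "e > 0" for e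
  proof -
    from that obtain F where "finite F" "F \<subseteq> (onb::'a set)" "dist (sum ?g F) l \<le> e/2"
      using has_sum_finite_approximation[OF hs, of "e/2"] by auto
    moreover from this that have "l - e < sum ?g F"
      unfolding dist_real_def by linarith
    ultimately show ?thesis by blast
  qed
  have tail: "sum ?g H \<le> e" if "finite F" "F \<subseteq> (onb::'a set)" "l - e < sum ?g F"
    "finite H" "H \<subseteq> onb" "H \<inter> F = {}" for F H e
  proof -
    have "sum ?g (F \<union> H) \<le> l"
      using that by (intro finite_sum_le_has_sum[OF hs]) auto
    moreover have "sum ?g (F \<union> H) = sum ?g F + sum ?g H"
      by (rule sum.union_disjoint) (use that in auto)
    ultimately show ?thesis using that(3) by linarith
  qed
  define Fn where "Fn n = (SOME F. finite F \<and> F \<subseteq> (onb::'a set) \<and> l - (1/2^n)^2 < sum ?g F)" for n :: nat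
  have Fn: "finite (Fn n)" "Fn n \<subseteq> onb" "l - (1/2^n)^2 < sum ?g (Fn n)" for n
    using someI_ex[OF ap[of "(1/2^n)^2"]] by (auto simp: Fn_def)
  define Vn where "Vn n = (\<Union>k\<le>n. Fn k)" for n
  have Vn: "finite (Vn n)" "Vn n \<subseteq> onb" for n using Fn by (auto simp: Vn_def)
  have Vn_mono: "Vn m \<subseteq> Vn n" if "m \<le> n" for m n
    unfolding Vn_def using that by (intro UN_mono) auto
  have near: "norm (?G H - ?G (Vn n)) \<le> 1/2^n" if "finite H" "H \<subseteq> onb" "Vn n \<subseteq> H" for n H
  proof -
    have eq: "?G H - ?G (Vn n) = ?G (H - Vn n)"
      using sum_diff[OF that(1,3), of "\<lambda>e. c e *\<^sub>C e"] by simp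
    have "(norm (?G (H - Vn n)))\<^sup>2 \<le> (1/2^n)^2"
    proof (subst norm_onb_sum)
      show "sum ?g (H - Vn n) \<le> (1/2^n)\<^sup>2"
        by (rule tail[OF Fn[of n]]) (use that in \<open>auto simp: Vn_def\<close>)
    qed (use that in auto)
    then show ?thesis unfolding eq by (rule power2_le_imp_le) simp
  qed
  have "Cauchy (\<lambda>n. ?G (Vn n))"
  proof (rule metric_CauchyI)
    fix e :: real assume "e > 0"
    then obtain N where N: "1/2^N < e / 2"
      using real_arch_pow_inv[of "e/2" "1/2"] by (auto simp: power_one_over)
    have d: "dist (?G (Vn m)) (?G (Vn N)) \<le> 1/2^N" if "m \<ge> N" for m
      unfolding dist_norm by (rule near[OF Vn Vn_mono[OF that]])
    have "dist (?G (Vn m)) (?G (Vn n)) < e" if "m \<ge> N" "n \<ge> N" for m n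
    proof -
      have "dist (?G (Vn m)) (?G (Vn N)) \<le> 1/2^N" "dist (?G (Vn n)) (?G (Vn N)) \<le> 1/2^N"
        using d that by blast+
      then show ?thesis
        using N dist_triangle2[of "?G (Vn m)" "?G (Vn n)" "?G (Vn N)"] by linarith
    qed
    then show "\<exists>M. \<forall>m\<ge>M. \<forall>n\<ge>M. dist (?G (Vn m)) (?G (Vn n)) < e"
      by blast
  qed
  then obtain s where s: "(\<lambda>n. ?G (Vn n)) \<longlonglongrightarrow> s"
    by (auto dest!: Cauchy_convergent simp only: convergent_def)
  have "((\<lambda>e. c e *\<^sub>C e) has_sum s) onb"
    unfolding has_sum_def tendsto_iff eventually_finite_subsets_at_top
  proof (intro allI impI)
    fix e :: real assume "e > 0"
    then obtain N where N: "1/2^N < e / 2"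
      using real_arch_pow_inv[of "e/2" "1/2"] by (auto simp: power_one_over)
    from s \<open>e > 0\<close> obtain N' where N': "\<And>n. n \<ge> N' \<Longrightarrow> dist (?G (Vn n)) s < e/2"
      unfolding lim_sequentially by (meson half_gt_zero)
    define n where "n = max N N'"
    have n: "n \<ge> N'" "(1::real)/2^n \<le> 1/2^N"
      unfolding n_def by (auto intro!: divide_left_mono power_increasing)
    have "dist (?G H) s < e" if "finite H" "Vn n \<subseteq> H" "H \<subseteq> onb" for H
    proof -
      have "dist (?G H) (?G (Vn n)) \<le> 1/2^n"
        unfolding dist_norm by (rule near) (use that in auto)
      with n N N'[OF n(1)] dist_triangle[of "?G H" s "?G (Vn n)"] show ?thesis by linarith
    qed
    then show "\<exists>X. finite X \<and> X \<subseteq> onb \<and> (\<forall>Y. finite Y \<and> X \<subseteq> Y \<and> Y \<subseteq> onb \<longrightarrow> dist (?G Y) s < e)"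
      using Vn[of n] by (intro exI[of _ "Vn n"]) simp
  qed
  then show ?thesis unfolding summable_on_def by (rule exI)
qed

lemma cinner_onb_sum:
  assumes "((\<lambda>e. c e *\<^sub>C e) has_sum s) onb" "b \<in> onb"
  shows "cinner b s = c b"
proof -
  have "((\<lambda>e. cinner b (c e *\<^sub>C e)) has_sum cinner b s) onb"
    by (rule has_sum_bounded_linear[OF bounded_linear_cinner_right assms(1)])
  moreover have "((\<lambda>e. cinner b (c e *\<^sub>C e)) has_sum (\<Sum>e\<in>{b}. cinner b (c e *\<^sub>C e))) onb"
    by (rule has_sum_finite_neutralI[of "{b}"])
      (use assms(2) in \<open>auto simp: cinner_scaleC_right onb_cinner\<close>)
  ultimately have "cinner b s = (\<Sum>e\<in>{b}. cinner b (c e *\<^sub>C e))"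
    by (rule has_sum_unique)
  then show ?thesis
    using assms(2) by (simp add: cinner_scaleC_right onb_cinner)
qed

lemma onb_expansion: "((\<lambda>e. cinner e x *\<^sub>C e) has_sum x) onb"
proof -
  obtain s where s: "((\<lambda>e. cinner e x *\<^sub>C e) has_sum s) onb"
    using onb_summable[OF onb_bessel] by (auto simp: summable_on_def)
  have "x - s = 0"
    by (rule onb_complete) (simp add: cinner_diff_right cinner_onb_sum[OF s])
  with s show ?thesis by simp
qed

lemma onb_parseval: "((\<lambda>e. cinner x e * cinner e y) has_sum cinner x y) onb"
  using has_sum_bounded_linear[OF bounded_linear_cinner_right[of x] onb_expansion[of y]]
  by (simp add: cinner_scaleC_right mult.commute)


section \<open>Bounded operators\<close>

text \<open>
  \<^typ>\<open>'h \<Rightarrow>\<^sub>L 'h\<close> is the type of bounded real-linear maps; \<open>bounded_ops\<close> is $\mathcal{B}(H)$.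
\<close>

definition bounded_ops :: "('h::chilbert_space \<Rightarrow>\<^sub>L 'h) set" where
  "bounded_ops = {T :: 'h \<Rightarrow>\<^sub>L 'h. \<forall>c x. T (c *\<^sub>C x) = c *\<^sub>C T x}"

definition cadjoint :: "('h::chilbert_space \<Rightarrow>\<^sub>L 'h) \<Rightarrow> ('h \<Rightarrow>\<^sub>L 'h)" where
  "cadjoint T = (THE S :: 'h \<Rightarrow>\<^sub>L 'h. \<forall>x y. cinner (S x) y = cinner x (T y))"

lemma cinner_cadjoint:
  assumes T: "T \<in> bounded_ops"
  shows "cinner (cadjoint T x) y = cinner x (T y)"
proof -
  let ?P = "\<lambda>S :: 'a \<Rightarrow>\<^sub>L 'a. \<forall>x y. cinner (S x) y = cinner x (T y)"
  have ext: "u = v" if "\<And>y. cinner u y = cinner v y" for u v :: 'a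
    using that[of "u - v"] cinner_self[of "u - v"] by (simp add: cinner_diff_left)
  have ex: "\<exists>z. (\<forall>y. cinner z y = cinner x (T y)) \<and> norm z \<le> norm x * norm T" for x
  proof -
    let ?c = "\<lambda>e. cinner (T e) x"
    have T_sum: "T (\<Sum>e\<in>F. f e *\<^sub>C e) = (\<Sum>e\<in>F. f e *\<^sub>C T e)" for F and f :: "'a \<Rightarrow> complex"
      using T by (simp add: blinfun.sum_right bounded_ops_def)
    have "(\<lambda>e. (cmod (?c e))\<^sup>2) summable_on onb"
    proof (rule nonneg_bdd_above_summable_on)
      show "bdd_above (sum (\<lambda>e. (cmod (?c e))\<^sup>2) ` {F. F \<subseteq> onb \<and> finite F})"
      proof (rule bdd_aboveI2[where M="(norm T * norm x)\<^sup>2"], clarify)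
        fix F :: "'a set" assume F: "F \<subseteq> onb" "finite F"
        let ?S = "\<Sum>e\<in>F. (cmod (?c e))\<^sup>2"
        let ?s = "\<Sum>e\<in>F. ?c e *\<^sub>C e"
        have ns: "(norm ?s)\<^sup>2 = ?S" by (rule norm_onb_sum) (use F in auto)
        have "cinner (T ?s) x = complex_of_real ?S"
          by (simp add: T_sum cinner_sum_left cinner_scaleC_left complex_norm_square mult.commute
            del: of_real_power)
        then have "?S \<le> cmod (cinner (T ?s) x)"
          by (simp add: abs_ge_self del: of_real_sum)
        also have "\<dots> \<le> norm (T ?s) * norm x" by (rule norm_cinner_le)
        also have "\<dots> \<le> norm T * norm ?s * norm x"
          by (intro mult_right_mono norm_blinfun) simp
        finally have "(norm ?s)\<^sup>2 \<le> (norm T * norm x) * norm ?s"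
          by (simp add: ns mult_ac)
        then have "norm ?s \<le> norm T * norm x"
          by (cases "norm ?s = 0") (auto simp: power2_eq_square)
        then show "?S \<le> (norm T * norm x)\<^sup>2"
          unfolding ns[symmetric] by (intro power_mono) auto
      qed
    qed auto
    from onb_summable[OF this] obtain z where z: "((\<lambda>e. ?c e *\<^sub>C e) has_sum z) onb"
      by (auto simp: summable_on_def)
    have "cinner z y = cinner x (T y)" for y
    proof -
      have zT: "cinner x (T (cinner e y *\<^sub>C e)) = cinner z e * cinner e y" if "e \<in> onb" for e
      proof -
        have "cinner z e = cinner x (T e)"
          using cinner_onb_sum[OF z that] cinner_commute[of z e] cinner_commute[of x "T e"] by simp
        with T show ?thesis by (simp add: bounded_ops_def cinner_scaleC_right)
      qed
      have "((\<lambda>e. cinner x (T (cinner e y *\<^sub>C e))) has_sum cinner x (T y)) onb"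
        by (rule has_sum_bounded_linear[OF bounded_linear_cinner_right
            has_sum_bounded_linear[OF blinfun.bounded_linear_right onb_expansion]])
      then have "((\<lambda>e. cinner z e * cinner e y) has_sum cinner x (T y)) onb"
        by (simp only: zT cong: has_sum_cong)
      with onb_parseval show ?thesis by (rule has_sum_unique)
    qed
    moreover have "norm z \<le> norm x * norm T"
    proof -
      have "(norm z)\<^sup>2 = inner x (T z)"
        using calculation[of z] by (simp add: power2_norm_eq_inner inner_eq_Re_cinner)
      also have "\<dots> \<le> norm x * norm (T z)" by (rule norm_cauchy_schwarz)
      also have "\<dots> \<le> norm x * (norm T * norm z)"
        by (intro mult_left_mono norm_blinfun) simp
      finally show ?thesis
        by (cases "norm z = 0") (auto simp: power2_eq_square mult_ac)
    qed
    ultimately show ?thesis by blast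
  qed
  then obtain S where S: "\<And>x y. cinner (S x) y = cinner x (T y)"
    and nS: "\<And>x. norm (S x) \<le> norm x * norm T" by metis
  have "bounded_linear S"
  proof (rule bounded_linear_intro[OF _ _ nS])
    show "S (x + y) = S x + S y" for x y by (rule ext) (simp add: S cinner_add_left)
    show "S (r *\<^sub>R x) = r *\<^sub>R S x" for r x by (rule ext) (simp add: S cinner_scaleR_left)
  qed
  then have "?P (Blinfun S)" by (simp add: bounded_linear_Blinfun_apply S)
  moreover have "S1 = S2" if "?P S1" "?P S2" for S1 S2
    using that by (intro blinfun_eqI ext) metis
  ultimately have "?P (cadjoint T)" unfolding cadjoint_def by - (rule theI[where P="?P"])
  then show ?thesis by blast
qed


section \<open>Von Neumann algebras\<close>

definition commutant :: "('h::chilbert_space \<Rightarrow>\<^sub>L 'h) set \<Rightarrow> ('h \<Rightarrow>\<^sub>L 'h) set" where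
  "commutant A = {T \<in> bounded_ops. \<forall>S\<in>A. T o\<^sub>L S = S o\<^sub>L T}"

text \<open>
  Being a commutant, such an $M$ is automatically a weakly closed subalgebra of $\mathcal{B}(H)$
  that contains the identity operator.
\<close>

definition von_neumann_algebra :: "('h::chilbert_space \<Rightarrow>\<^sub>L 'h) set \<Rightarrow> bool" where
  "von_neumann_algebra M \<longleftrightarrow>
    M \<subseteq> bounded_ops \<and> (\<forall>T\<in>M. cadjoint T \<in> M) \<and> commutant (commutant M) = M"

definition vn_subalgebra :: "('h::chilbert_space \<Rightarrow>\<^sub>L 'h) set \<Rightarrow> ('h \<Rightarrow>\<^sub>L 'h) set \<Rightarrow> bool" where
  "vn_subalgebra N M \<longleftrightarrow> von_neumann_algebra N \<and> von_neumann_algebra M \<and> N \<subseteq> M"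

definition vn_generated :: "('h::chilbert_space \<Rightarrow>\<^sub>L 'h) set \<Rightarrow> ('h \<Rightarrow>\<^sub>L 'h) set" where
  "vn_generated S = \<Inter>{R. von_neumann_algebra R \<and> S \<subseteq> R}"

definition abelian :: "('h::chilbert_space \<Rightarrow>\<^sub>L 'h) set \<Rightarrow> bool" where
  "abelian A \<longleftrightarrow> (\<forall>S\<in>A. \<forall>T\<in>A. S o\<^sub>L T = T o\<^sub>L S)"

definition masa :: "('h::chilbert_space \<Rightarrow>\<^sub>L 'h) set \<Rightarrow> ('h \<Rightarrow>\<^sub>L 'h) set \<Rightarrow> bool" where
  "masa N M \<longleftrightarrow> vn_subalgebra N M \<and> abelian N \<and>
    (\<forall>A. vn_subalgebra A M \<and> abelian A \<and> N \<subseteq> A \<longrightarrow> A = N)"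

definition unitary :: "('h::chilbert_space \<Rightarrow>\<^sub>L 'h) \<Rightarrow> bool" where
  "unitary U \<longleftrightarrow> U \<in> bounded_ops \<and>
    cadjoint U o\<^sub>L U = id_blinfun \<and> U o\<^sub>L cadjoint U = id_blinfun"

definition singular_in :: "('h::chilbert_space \<Rightarrow>\<^sub>L 'h) set \<Rightarrow> ('h \<Rightarrow>\<^sub>L 'h) set \<Rightarrow> bool" where
  "singular_in N M \<longleftrightarrow> vn_subalgebra N M \<and>
    (\<forall>U\<in>M. unitary U \<and> (\<lambda>T. U o\<^sub>L T o\<^sub>L cadjoint U) ` N = N \<longrightarrow> U \<in> N)"


section \<open>The Hilbert space tensor product\<close>

text \<open>
  $H \otimes K$ is realised as the $\ell^2$-direct sum of copies of $H$ indexed by an orthonormal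
  basis of $K$. The lemmas below on \<open>tprod\<close> (bilinearity, the inner product of elementary
  tensors, and their totality) characterise the tensor product up to a unique unitary; in
  particular the choice of the basis is immaterial.
\<close>

typedef (overloaded) ('h::chilbert_space, 'k::chilbert_space) htensor =
  "{f :: 'k \<Rightarrow> 'h. (\<forall>e. e \<notin> onb \<longrightarrow> f e = 0) \<and> (\<lambda>e. (norm (f e))\<^sup>2) summable_on UNIV}"
  morphisms coord Abs_htensor
  by (rule exI[of _ "\<lambda>_. 0"]) simp

setup_lifting type_definition_htensor

lemma htensor_eqI: "(\<And>e. coord f e = coord g e) \<Longrightarrow> f = g"
  by (metis coord_inject ext)

lemma coord_outside: "e \<notin> onb \<Longrightarrow> coord f e = 0"
  using coord[of f] by auto

lemma coord_summable: "(\<lambda>e. (norm (coord f e))\<^sup>2) summable_on UNIV"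
  using coord[of f] by auto

lemma l2_add:
  fixes f g :: "'i \<Rightarrow> 'a::real_normed_vector"
  assumes "(\<lambda>e. (norm (f e))\<^sup>2) summable_on UNIV" "(\<lambda>e. (norm (g e))\<^sup>2) summable_on UNIV"
  shows "(\<lambda>e. (norm (f e + g e))\<^sup>2) summable_on UNIV"
proof (rule summable_on_comparison_test)
  show "(\<lambda>e. 2 * (norm (f e))\<^sup>2 + 2 * (norm (g e))\<^sup>2) summable_on UNIV"
    by (intro summable_on_add summable_on_cmult_right assms)
  show "(norm (f e + g e))\<^sup>2 \<le> 2 * (norm (f e))\<^sup>2 + 2 * (norm (g e))\<^sup>2" for e
  proof -
    have "(norm (f e + g e))\<^sup>2 \<le> (norm (f e) + norm (g e))\<^sup>2"
      by (intro power_mono norm_triangle_ineq) simp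
    also have "\<dots> \<le> 2 * (norm (f e))\<^sup>2 + 2 * (norm (g e))\<^sup>2"
      using sum_squares_bound[of "norm (f e)" "norm (g e)"] by (simp add: power2_sum)
    finally show ?thesis .
  qed
qed simp

lemma l2_diff:
  fixes f g :: "'i \<Rightarrow> 'a::real_normed_vector"
  assumes "(\<lambda>e. (norm (f e))\<^sup>2) summable_on UNIV" "(\<lambda>e. (norm (g e))\<^sup>2) summable_on UNIV"
  shows "(\<lambda>e. (norm (f e - g e))\<^sup>2) summable_on UNIV"
  using l2_add[of f "\<lambda>e. - g e"] assms by simp

lemma l2_cinner_abs_summable:
  fixes f g :: "'i \<Rightarrow> 'a::chilbert_space"
  assumes "(\<lambda>e. (norm (f e))\<^sup>2) summable_on UNIV" "(\<lambda>e. (norm (g e))\<^sup>2) summable_on UNIV"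
  shows "(\<lambda>e. norm (cinner (f e) (g e))) summable_on UNIV"
proof (rule summable_on_comparison_test)
  show "(\<lambda>e. (norm (f e))\<^sup>2 + (norm (g e))\<^sup>2) summable_on UNIV"
    by (intro summable_on_add assms)
  show "norm (cinner (f e) (g e)) \<le> (norm (f e))\<^sup>2 + (norm (g e))\<^sup>2" for e
  proof -
    have "0 \<le> norm (f e) * norm (g e)" by simp
    then show ?thesis
      using norm_cinner_le[of "f e" "g e"] sum_squares_bound[of "norm (f e)" "norm (g e)"]
      by linarith
  qed
qed simp

instantiation htensor :: (chilbert_space, chilbert_space) real_vector
begin

lift_definition zero_htensor :: "('a, 'b) htensor" is "\<lambda>_. 0" by simp

lift_definition plus_htensor :: "('a, 'b) htensor \<Rightarrow> ('a, 'b) htensor \<Rightarrow> ('a, 'b) htensor"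
  is "\<lambda>f g e. f e + g e" by (simp add: l2_add)

lift_definition uminus_htensor :: "('a, 'b) htensor \<Rightarrow> ('a, 'b) htensor"
  is "\<lambda>f e. - f e" by simp

lift_definition minus_htensor :: "('a, 'b) htensor \<Rightarrow> ('a, 'b) htensor \<Rightarrow> ('a, 'b) htensor"
  is "\<lambda>f g e. f e - g e" by (simp add: l2_diff)

lift_definition scaleR_htensor :: "real \<Rightarrow> ('a, 'b) htensor \<Rightarrow> ('a, 'b) htensor"
  is "\<lambda>r f e. r *\<^sub>R f e"
  by (simp add: power_mult_distrib summable_on_cmult_right)

instance
proof
  fix x y z :: "('a, 'b) htensor" and r s :: real
  note coord_simps = zero_htensor.rep_eq plus_htensor.rep_eq uminus_htensor.rep_eq
    minus_htensor.rep_eq scaleR_htensor.rep_eq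
  show "x + y + z = x + (y + z)" "x + y = y + x" "0 + x = x" "- x + x = 0" "x - y = x + - y"
    "r *\<^sub>R (x + y) = r *\<^sub>R x + r *\<^sub>R y" "(r + s) *\<^sub>R x = r *\<^sub>R x + s *\<^sub>R x"
    "r *\<^sub>R s *\<^sub>R x = (r * s) *\<^sub>R x" "1 *\<^sub>R x = x"
    by (rule htensor_eqI; simp add: coord_simps algebra_simps)+
qed

end

instantiation htensor :: (chilbert_space, chilbert_space) real_normed_vector
begin

definition norm_htensor :: "('a, 'b) htensor \<Rightarrow> real" where
  "norm f = sqrt (\<Sum>\<^sub>\<infinity>e. (norm (coord f e))\<^sup>2)"

definition sgn_htensor :: "('a, 'b) htensor \<Rightarrow> ('a, 'b) htensor" where
  "sgn (f :: ('a, 'b) htensor) = f /\<^sub>R norm f"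

definition dist_htensor :: "('a, 'b) htensor \<Rightarrow> ('a, 'b) htensor \<Rightarrow> real" where
  "dist (f :: ('a, 'b) htensor) g = norm (f - g)"

definition uniformity_htensor :: "(('a, 'b) htensor \<times> ('a, 'b) htensor) filter" where
  "uniformity = (INF e\<in>{0<..}. principal {(x :: ('a, 'b) htensor, y). dist x y < e})"

definition open_htensor :: "('a, 'b) htensor set \<Rightarrow> bool" where
  "open (U :: ('a, 'b) htensor set) = (\<forall>x\<in>U. eventually (\<lambda>(x', y). x' = x \<longrightarrow> y \<in> U) uniformity)"

lemma has_sum_norm_htensor: "((\<lambda>e. (norm (coord f e))\<^sup>2) has_sum (norm f)\<^sup>2) UNIV"
  using has_sum_infsum[OF coord_summable[of f]] by (simp add: norm_htensor_def infsum_nonneg)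

instance
proof
  fix x y :: "('a, 'b) htensor" and r :: real
  note coord_simps = zero_htensor.rep_eq plus_htensor.rep_eq scaleR_htensor.rep_eq
  have norm_nonneg: "0 \<le> norm f" for f :: "('a, 'b) htensor"
    by (simp add: norm_htensor_def infsum_nonneg)
  have part: "L2_set (\<lambda>e. norm (coord f e)) F \<le> norm f" if "finite F" for f :: "('a, 'b) htensor" and F
    unfolding L2_set_def norm_htensor_def
    by (intro real_sqrt_le_mono finite_sum_le_infsum coord_summable) (use that in auto)
  show "norm x = 0 \<longleftrightarrow> x = 0"
  proof
    assume 0: "norm x = 0"
    have "(norm (coord x e))\<^sup>2 = 0" for e
      by (rule nonneg_has_sum_le_0D[OF has_sum_norm_htensor]) (simp_all add: 0)
    then show "x = 0" by (intro htensor_eqI) (simp add: coord_simps)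
  qed (simp add: norm_htensor_def coord_simps)
  show "norm (x + y) \<le> norm x + norm y"
  proof -
    have "(norm (x + y))\<^sup>2 \<le> (norm x + norm y)\<^sup>2"
    proof (rule has_sum_le_finite_sums[OF has_sum_norm_htensor])
      fix F :: "'b set" assume F: "finite F"
      have "L2_set (\<lambda>e. norm (coord (x + y) e)) F \<le> L2_set (\<lambda>e. norm (coord x e) + norm (coord y e)) F"
        by (intro L2_set_mono) (simp_all add: coord_simps norm_triangle_ineq)
      also have "\<dots> \<le> norm x + norm y"
        using L2_set_triangle_ineq[of "\<lambda>e. norm (coord x e)" "\<lambda>e. norm (coord y e)" F]
          part[OF F, of x] part[OF F, of y] by simp
      finally show "(\<Sum>e\<in>F. (norm (coord (x + y) e))\<^sup>2) \<le> (norm x + norm y)\<^sup>2"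
        unfolding L2_set_def by (rule sqrt_le_D)
    qed
    then show ?thesis by (rule power2_le_imp_le) (intro add_nonneg_nonneg norm_nonneg)
  qed
  show "norm (r *\<^sub>R x) = \<bar>r\<bar> * norm x"
    by (simp add: norm_htensor_def coord_simps power_mult_distrib infsum_cmult_right'
      real_sqrt_mult)
qed (rule sgn_htensor_def dist_htensor_def uniformity_htensor_def open_htensor_def)+

end

instantiation htensor :: (chilbert_space, chilbert_space) real_inner
begin

definition inner_htensor :: "('a, 'b) htensor \<Rightarrow> ('a, 'b) htensor \<Rightarrow> real" where
  "inner f g = (\<Sum>\<^sub>\<infinity>e. inner (coord f e) (coord g e))"

lemma has_sum_inner_htensor: "((\<lambda>e. inner (coord f e) (coord g e)) has_sum inner f g) UNIV"
  unfolding inner_htensor_def inner_eq_Re_cinner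
  by (rule has_sum_infsum[OF summable_on_Re[OF abs_summable_summable[OF
      l2_cinner_abs_summable[OF coord_summable coord_summable]]]])

instance
proof
  fix x y z :: "('a, 'b) htensor" and r :: real
  show "inner x y = inner y x"
    by (simp add: inner_htensor_def inner_commute)
  show "inner (x + y) z = inner x z + inner y z"
    by (rule has_sum_unique[OF has_sum_inner_htensor])
      (simp add: plus_htensor.rep_eq inner_add_left has_sum_add has_sum_inner_htensor)
  show "inner (r *\<^sub>R x) y = r * inner x y"
    by (rule has_sum_unique[OF has_sum_inner_htensor])
      (simp add: scaleR_htensor.rep_eq has_sum_cmult_right has_sum_inner_htensor)
  show ge: "0 \<le> inner x x" by (rule has_sum_nonneg[OF has_sum_inner_htensor]) simp
  show n: "norm x = sqrt (inner x x)"
    by (simp add: norm_htensor_def inner_htensor_def power2_norm_eq_inner)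
  show "inner x x = 0 \<longleftrightarrow> x = 0"
    using norm_eq_zero[of x] unfolding n by simp
qed

end

lemma norm_coord_le: "norm (coord f e) \<le> norm f"
proof -
  have "(\<Sum>e\<in>{e}. (norm (coord f e))\<^sup>2) \<le> (norm f)\<^sup>2"
    by (rule finite_sum_le_has_sum[OF has_sum_norm_htensor]) auto
  then have "(norm (coord f e))\<^sup>2 \<le> (norm f)\<^sup>2" by simp
  then show ?thesis by (rule power2_le_imp_le) simp
qed

instance htensor :: (chilbert_space, chilbert_space) complete_space
proof
  fix X :: "nat \<Rightarrow> ('a, 'b) htensor"
  assume X: "Cauchy X"
  have "Cauchy (\<lambda>n. coord (X n) e)" for e
  proof (rule metric_CauchyI)
    fix r :: real assume "r > 0"
    then obtain N where "\<forall>m\<ge>N. \<forall>n\<ge>N. dist (X m) (X n) < r"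
      using X by (meson metric_CauchyD)
    moreover have "dist (coord (X m) e) (coord (X n) e) \<le> dist (X m) (X n)" for m n
      using norm_coord_le[of "X m - X n" e] by (simp add: dist_norm minus_htensor.rep_eq)
    ultimately show "\<exists>N. \<forall>m\<ge>N. \<forall>n\<ge>N. dist (coord (X m) e) (coord (X n) e) < r"
      by (meson le_less_trans)
  qed
  then have "\<exists>l. (\<lambda>n. coord (X n) e) \<longlonglongrightarrow> l" for e
    using Cauchy_convergent convergent_def by blast
  then obtain g where g: "\<And>e. (\<lambda>n. coord (X n) e) \<longlonglongrightarrow> g e" by metis
  have fin: "\<exists>N. \<forall>m\<ge>N. \<forall>F. finite F \<longrightarrow> (\<Sum>e\<in>F. (norm (coord (X m) e - g e))\<^sup>2) \<le> r\<^sup>2"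
    if "r > 0" for r :: real
  proof -
    obtain N where N: "\<forall>m\<ge>N. \<forall>n\<ge>N. dist (X m) (X n) < r"
      using X \<open>r > 0\<close> by (meson metric_CauchyD)
    have "(\<Sum>e\<in>F. (norm (coord (X m) e - g e))\<^sup>2) \<le> r\<^sup>2" if "m \<ge> N" "finite F" for m F
    proof (rule LIMSEQ_le_const2)
      show "(\<lambda>n. \<Sum>e\<in>F. (norm (coord (X m) e - coord (X n) e))\<^sup>2)
          \<longlonglongrightarrow> (\<Sum>e\<in>F. (norm (coord (X m) e - g e))\<^sup>2)"
        by (intro tendsto_intros g)
      show "\<exists>N. \<forall>n\<ge>N. (\<Sum>e\<in>F. (norm (coord (X m) e - coord (X n) e))\<^sup>2) \<le> r\<^sup>2"
      proof (intro exI allI impI)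
        fix n assume "n \<ge> N"
        have "(\<Sum>e\<in>F. (norm (coord (X m - X n) e))\<^sup>2) \<le> (norm (X m - X n))\<^sup>2"
          by (rule finite_sum_le_has_sum[OF has_sum_norm_htensor]) (use that in auto)
        also have "\<dots> \<le> r\<^sup>2"
          using N \<open>n \<ge> N\<close> \<open>m \<ge> N\<close> by (intro power_mono) (auto simp: dist_norm less_imp_le)
        finally show "(\<Sum>e\<in>F. (norm (coord (X m) e - coord (X n) e))\<^sup>2) \<le> r\<^sup>2"
          by (simp add: minus_htensor.rep_eq)
      qed
    qed
    then show ?thesis by blast
  qed
  obtain N1 where N1: "\<And>F. finite F \<Longrightarrow> (\<Sum>e\<in>F. (norm (coord (X N1) e - g e))\<^sup>2) \<le> 1\<^sup>2"
    using fin[of 1] by auto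
  have d: "(\<lambda>e. (norm (coord (X N1) e - g e))\<^sup>2) summable_on UNIV"
    by (rule nonneg_bdd_above_summable_on) (use N1 in \<open>auto intro!: bdd_aboveI2[where M="1\<^sup>2"]\<close>)
  have "(\<lambda>e. (norm (g e))\<^sup>2) summable_on UNIV"
    using l2_diff[OF coord_summable[of "X N1"] d] by simp
  moreover have "g e = 0" if "e \<notin> onb" for e
    using g[of e] that by (simp add: coord_outside LIMSEQ_const_iff)
  ultimately obtain G where G: "coord G = g"
    using Abs_htensor_inverse[of g] by auto
  have "X \<longlonglongrightarrow> G"
  proof (rule metric_LIMSEQ_I)
    fix r :: real assume "r > 0"
    then obtain N where N: "\<And>m F. m \<ge> N \<Longrightarrow> finite F \<Longrightarrow>
        (\<Sum>e\<in>F. (norm (coord (X m) e - g e))\<^sup>2) \<le> (r/2)\<^sup>2"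
      using fin[of "r/2"] by auto
    have "dist (X m) G < r" if "m \<ge> N" for m
    proof -
      have "(norm (X m - G))\<^sup>2 \<le> (r/2)\<^sup>2"
        by (rule has_sum_le_finite_sums[OF has_sum_norm_htensor])
          (use N[OF that] in \<open>auto simp: minus_htensor.rep_eq G\<close>)
      then have "norm (X m - G) \<le> r/2"
        by (rule power2_le_imp_le) (use \<open>r > 0\<close> in simp)
      with \<open>r > 0\<close> show ?thesis by (simp add: dist_norm)
    qed
    then show "\<exists>N. \<forall>n\<ge>N. dist (X n) G < r" by blast
  qed
  then show "convergent X" by (auto simp: convergent_def)
qed

instantiation htensor :: (chilbert_space, chilbert_space) chilbert_space
begin

lift_definition scaleC_htensor :: "complex \<Rightarrow> ('a, 'b) htensor \<Rightarrow> ('a, 'b) htensor"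
  is "\<lambda>c f e. c *\<^sub>C f e"
  by (simp add: norm_scaleC power_mult_distrib summable_on_cmult_right)

definition cinner_htensor :: "('a, 'b) htensor \<Rightarrow> ('a, 'b) htensor \<Rightarrow> complex" where
  "cinner f g = (\<Sum>\<^sub>\<infinity>e. cinner (coord f e) (coord g e))"

lemma has_sum_cinner_htensor:
  "((\<lambda>e. cinner (coord f e) (coord g e)) has_sum cinner f g) UNIV"
  unfolding cinner_htensor_def
  by (rule has_sum_infsum[OF abs_summable_summable[OF
      l2_cinner_abs_summable[OF coord_summable coord_summable]]])

instance
proof
  fix x y z :: "('a, 'b) htensor" and a b :: complex and r :: real
  show "a *\<^sub>C (x + y) = a *\<^sub>C x + a *\<^sub>C y" "(a + b) *\<^sub>C x = a *\<^sub>C x + b *\<^sub>C x"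
    "a *\<^sub>C b *\<^sub>C x = (a * b) *\<^sub>C x" "complex_of_real r *\<^sub>C x = r *\<^sub>R x"
    by (rule htensor_eqI; simp add: scaleC_htensor.rep_eq plus_htensor.rep_eq scaleR_htensor.rep_eq
        scaleC_add_right scaleC_add_left scaleC_scaleC scaleC_of_real)+
  show "cinner x y = cnj (cinner y x)"
    unfolding cinner_htensor_def infsum_cnj[symmetric]
    by (rule infsum_cong) (rule cinner_commute)
  show "cinner x (y + z) = cinner x y + cinner x z"
    by (rule has_sum_unique[OF has_sum_cinner_htensor])
      (simp add: plus_htensor.rep_eq cinner_add_right has_sum_add has_sum_cinner_htensor)
  show "cinner x (a *\<^sub>C y) = a * cinner x y"
    by (rule has_sum_unique[OF has_sum_cinner_htensor])
      (simp add: scaleC_htensor.rep_eq cinner_scaleC_right has_sum_cmult_right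
        has_sum_cinner_htensor)
  show "inner x y = Re (cinner x y)"
    by (rule has_sum_unique[OF has_sum_inner_htensor])
      (simp add: inner_eq_Re_cinner has_sum_Re has_sum_cinner_htensor)
qed

end

lift_definition tprod :: "'h::chilbert_space \<Rightarrow> 'k::chilbert_space \<Rightarrow> ('h, 'k) htensor"
    (infixr "\<otimes>" 75)
  is "\<lambda>a b e. if e \<in> onb then cinner e b *\<^sub>C a else 0"
proof
  fix a :: 'h and b :: 'k
  have "(\<lambda>e. (norm (cinner e b *\<^sub>C a))\<^sup>2) summable_on onb"
    using summable_on_cmult_left[OF onb_bessel[of b], of "(norm a)\<^sup>2"]
    by (simp add: norm_scaleC power_mult_distrib)
  then show "(\<lambda>e. (norm (if e \<in> onb then cinner e b *\<^sub>C a else 0))\<^sup>2) summable_on UNIV"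
    by (rule summable_on_cong_neutral[THEN iffD1, rotated -1]) auto
qed simp

lemma tprod_add_left: "(a + a') \<otimes> b = a \<otimes> b + a' \<otimes> b"
  by (rule htensor_eqI) (simp add: tprod.rep_eq plus_htensor.rep_eq scaleC_add_right)

lemma tprod_add_right: "a \<otimes> (b + b') = a \<otimes> b + a \<otimes> b'"
  by (rule htensor_eqI)
    (simp add: tprod.rep_eq plus_htensor.rep_eq cinner_add_right scaleC_add_left)

lemma tprod_scaleC_left: "(c *\<^sub>C a) \<otimes> b = c *\<^sub>C (a \<otimes> b)"
  by (rule htensor_eqI)
    (simp add: tprod.rep_eq scaleC_htensor.rep_eq scaleC_scaleC mult.commute)

lemma tprod_scaleC_right: "a \<otimes> (c *\<^sub>C b) = c *\<^sub>C (a \<otimes> b)"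
  by (rule htensor_eqI)
    (simp add: tprod.rep_eq scaleC_htensor.rep_eq scaleC_scaleC cinner_scaleC_right)

lemma cinner_tprod: "cinner (a \<otimes> b) (c \<otimes> d) = cinner a c * cinner b d"
proof -
  have "((\<lambda>e. cinner a c * (cinner b e * cinner e d)) has_sum cinner a c * cinner b d) onb"
    by (intro has_sum_cmult_right onb_parseval)
  then have "((\<lambda>e. cinner (coord (a \<otimes> b) e) (coord (c \<otimes> d) e)) has_sum cinner a c * cinner b d) UNIV"
    by (rule has_sum_cong_neutral[THEN iffD1, rotated -1])
      (auto simp: tprod.rep_eq cinner_scaleC_left cinner_scaleC_right cinner_commute[of b] mult_ac)
  then show ?thesis by (rule has_sum_unique[OF has_sum_cinner_htensor])
qed

lemma has_sum_diff_real:
  fixes f g :: "'i \<Rightarrow> real"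
  assumes "(f has_sum a) A" "(g has_sum b) A"
  shows "((\<lambda>x. f x - g x) has_sum a - b) A"
  using has_sum_add[OF assms(1) has_sum_uminusI[OF assms(2)]] by simp

lemma tprod_total: "closure (span (range (\<lambda>(a, b). a \<otimes> b))) = UNIV"
proof -
  let ?R = "range (\<lambda>(a :: 'a, b :: 'b). a \<otimes> b)"
  have "f \<in> closure (span ?R)" for f :: "('a, 'b) htensor"
  proof -
    have part: "\<exists>g\<in>span ?R. (norm (f - g))\<^sup>2 = (norm f)\<^sup>2 - (\<Sum>e\<in>F. (norm (coord f e))\<^sup>2)"
      if "finite F" for F
    proof -
      let ?g = "\<Sum>e\<in>F \<inter> onb. coord f e \<otimes> e"
      have coord_sum: "coord (sum h A) e = (\<Sum>i\<in>A. coord (h i) e)"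
        for h :: "'b \<Rightarrow> ('a, 'b) htensor" and A e
        by (induction A rule: infinite_finite_induct)
          (simp_all add: zero_htensor.rep_eq plus_htensor.rep_eq)
      have "coord ?g d = (if d \<in> F then coord f d else 0)" for d
      proof (cases "d \<in> onb")
        case True
        have "coord ?g d = (\<Sum>e\<in>F \<inter> onb. if e = d then coord f d else 0)"
          unfolding coord_sum using True by (intro sum.cong) (auto simp: tprod.rep_eq onb_cinner)
        then show ?thesis using True that by simp
      qed (simp add: coord_sum coord_outside)
      then have cg: "coord (f - ?g) d = (if d \<in> F then 0 else coord f d)" for d
        by (simp add: minus_htensor.rep_eq)
      have "((\<lambda>e. (norm (coord f e))\<^sup>2 - (if e \<in> F then (norm (coord f e))\<^sup>2 else 0)) has_sum
          (norm f)\<^sup>2 - (\<Sum>e\<in>F. (norm (coord f e))\<^sup>2)) UNIV"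
        by (intro has_sum_diff_real has_sum_norm_htensor has_sum_finite_neutralI[of F]) (use that in auto)
      moreover have "(norm (coord f e))\<^sup>2 - (if e \<in> F then (norm (coord f e))\<^sup>2 else 0)
          = (norm (coord (f - ?g) e))\<^sup>2" for e
        by (simp add: cg)
      ultimately have "(norm (f - ?g))\<^sup>2 = (norm f)\<^sup>2 - (\<Sum>e\<in>F. (norm (coord f e))\<^sup>2)"
        using has_sum_norm_htensor[of "f - ?g"] by (simp add: has_sum_unique)
      moreover have "?g \<in> span ?R"
        by (intro span_sum span_base) auto
      ultimately show ?thesis by blast
    qed
    show ?thesis unfolding closure_approachable
    proof (intro allI impI)
      fix r :: real assume "r > 0"
      then obtain F where F: "finite F"
        "dist (\<Sum>e\<in>F. (norm (coord f e))\<^sup>2) ((norm f)\<^sup>2) \<le> (r/2)\<^sup>2"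
        using has_sum_finite_approximation[OF has_sum_norm_htensor[of f], of "(r/2)\<^sup>2"] by auto
      obtain g where g: "g \<in> span ?R" "(norm (f - g))\<^sup>2 \<le> (r/2)\<^sup>2"
        using part[OF F(1)] F(2) by (auto simp: dist_real_def abs_le_iff)
      have "norm (f - g) \<le> r/2" by (rule power2_le_imp_le[OF g(2)]) (use \<open>r > 0\<close> in simp)
      with g(1) \<open>r > 0\<close> show "\<exists>y\<in>span ?R. dist y f < r"
        by (intro bexI[of _ g]) (auto simp: dist_norm norm_minus_commute)
    qed
  qed
  then show ?thesis by blast
qed


section \<open>Tensor products of von Neumann algebras and complete singularity\<close>

text \<open>
  $x \otimes y$ is the unique bounded operator with
  $(x \otimes y)(a \otimes b) = xa \otimes yb$ for all $a$ and $b$.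
\<close>

definition is_tensor_op ::
    "('h::chilbert_space \<Rightarrow>\<^sub>L 'h) \<Rightarrow> ('k::chilbert_space \<Rightarrow>\<^sub>L 'k) \<Rightarrow>
      (('h, 'k) htensor \<Rightarrow>\<^sub>L ('h, 'k) htensor) \<Rightarrow> bool" where
  "is_tensor_op x y T \<longleftrightarrow> (\<forall>a b. T (a \<otimes> b) = x a \<otimes> y b)"

definition vn_tensor ::
    "('h::chilbert_space \<Rightarrow>\<^sub>L 'h) set \<Rightarrow> ('k::chilbert_space \<Rightarrow>\<^sub>L 'k) set \<Rightarrow>
      (('h, 'k) htensor \<Rightarrow>\<^sub>L ('h, 'k) htensor) set" where
  "vn_tensor M N = vn_generated {T. \<exists>x\<in>M. \<exists>y\<in>N. is_tensor_op x y T}"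

text \<open>
  HOL cannot quantify over types inside a formula, so the Hilbert space $K$ is a type parameter;
  complete singularity is the validity of this predicate for all types \<open>'k\<close>.
\<close>

definition completely_singular ::
    "'k::chilbert_space itself \<Rightarrow> ('h::chilbert_space \<Rightarrow>\<^sub>L 'h) set \<Rightarrow> ('h \<Rightarrow>\<^sub>L 'h) set \<Rightarrow> bool" where
  "completely_singular (K :: 'k itself) N M \<longleftrightarrow>
    singular_in (vn_tensor N (bounded_ops :: ('k \<Rightarrow>\<^sub>L 'k) set)) (vn_tensor M (bounded_ops :: ('k \<Rightarrow>\<^sub>L 'k) set))"

end

theory Submission
  imports Defs
begin

text \<open>
  Let $U \in M \mathbin{\bar\otimes} \mathcal{B}(K)$ be a unitary that normalizes
  $N \mathbin{\bar\otimes} \mathcal{B}(K)$. As $N$ is abelian, $U$ normalizes the centre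
  $N \otimes 1$ of that algebra, so there is a *-automorphism $\theta$ of $N$ with
  $U(n \otimes 1) = (\theta(n) \otimes 1)U$ (\<open>normalizer_induces_map\<close>). Every entry $W$ of the
  operator matrix of $U$ is then an element of $M$ with $Wn = \theta(n)W$ for all $n \in N$. Since
  $N \mathbin{\bar\otimes} \mathcal{B}(K)$ consists of the operators whose matrix entries are in
  $N$ (\<open>op_coef_in\<close>, \<open>in_vn_amplificationI\<close>), it suffices that such an intertwiner $W$ is in $N$
  (\<open>intertwiner_in_N\<close>).

  The key is that an intertwiner $a$ with $a^2 = 0$ vanishes (\<open>intertwiner_square_zero\<close>). The
  partial isometry $V$ in its polar decomposition is an intertwiner with $V^2 = 0$, and the
  self-adjoint unitary $V + V^* + (1 - V^*V - VV^*)$ normalizes $N$. By singularity it lies in $N$,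
  and because it commutes with $V^*V$ this forces $V = 0$.

  For a projection $e \in N$ this applies to $We(1 - \theta(e))$ and $W(1 - e)\theta(e)$. It follows
  that $We = W\theta(e)$ for all projections, and so $We = eW$. Signs of self-adjoint elements of
  $N$ are differences of projections and generate $N$ in norm, so $W$ commutes with $N$. As $N$ is
  maximal abelian, $W \in N' \cap M = N$ (\<open>masa_contains_relative_commutant\<close>).
\<close>

section \<open>Adjoints and von Neumann algebras\<close>

lemma cinner_ext:
  fixes u v :: "'h::chilbert_space"
  assumes "\<And>y. cinner u y = cinner v y"
  shows "u = v"
  using assms[of "u - v"] cinner_self[of "u - v"] by (simp add: cinner_diff_left)

lemma bounded_opsD: "T \<in> bounded_ops \<Longrightarrow> T (c *\<^sub>C x) = c *\<^sub>C T x"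
  by (simp add: bounded_ops_def)

lemma cadjoint_eqI:
  fixes S T :: "'h::chilbert_space \<Rightarrow>\<^sub>L 'h"
  assumes "T \<in> bounded_ops" and "\<And>x y. cinner (S x) y = cinner x (T y)"
  shows "cadjoint T = S"
  by (intro blinfun_eqI cinner_ext) (simp add: cinner_cadjoint[OF assms(1)] assms(2))

lemma cinner_cadjoint_right:
  assumes "T \<in> bounded_ops"
  shows "cinner x (cadjoint T y) = cinner (T x) y"
  using cinner_cadjoint[OF assms, of y x] cinner_commute by metis

lemma cadjoint_in_bounded_ops:
  assumes "T \<in> bounded_ops"
  shows "cadjoint T \<in> bounded_ops"
  unfolding bounded_ops_def
proof (intro CollectI allI cinner_ext)
  show "cinner (cadjoint T (c *\<^sub>C x)) y = cinner (c *\<^sub>C cadjoint T x) y" for c x y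
    by (simp add: cinner_cadjoint[OF assms] cinner_scaleC_left)
qed

lemma cadjoint_cadjoint: "T \<in> bounded_ops \<Longrightarrow> cadjoint (cadjoint T) = T"
  by (rule cadjoint_eqI) (simp_all add: cadjoint_in_bounded_ops cinner_cadjoint_right)

lemma scaleC_minus_right: "c *\<^sub>C (- x) = - (c *\<^sub>C (x :: 'h::chilbert_space))"
  using scaleC_add_right[of c x "- x"] by (simp add: eq_neg_iff_add_eq_0 add.commute)

lemma scaleC_diff_right: "c *\<^sub>C (x - y) = c *\<^sub>C x - c *\<^sub>C (y :: 'h::chilbert_space)"
  using scaleC_add_right[of c x "- y"] by (simp add: scaleC_minus_right)

lemma scaleC_scaleR: "c *\<^sub>C r *\<^sub>R x = r *\<^sub>R c *\<^sub>C (x :: 'h::chilbert_space)"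
  by (simp add: scaleC_scaleC mult.commute flip: scaleC_of_real)

lemma bounded_ops_closed:
  shows bounded_ops_id: "id_blinfun \<in> bounded_ops"
    and bounded_ops_compose: "S \<in> bounded_ops \<Longrightarrow> T \<in> bounded_ops \<Longrightarrow> S o\<^sub>L T \<in> bounded_ops"
    and bounded_ops_add: "S \<in> bounded_ops \<Longrightarrow> T \<in> bounded_ops \<Longrightarrow> S + T \<in> bounded_ops"
    and bounded_ops_diff: "S \<in> bounded_ops \<Longrightarrow> T \<in> bounded_ops \<Longrightarrow> S - T \<in> bounded_ops"
    and bounded_ops_scaleR: "T \<in> bounded_ops \<Longrightarrow> r *\<^sub>R T \<in> bounded_ops"
  by (simp_all add: bounded_ops_def blinfun.bilinear_simps scaleC_add_right scaleC_diff_right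
      scaleC_scaleR)

lemma cadjoint_id: "cadjoint id_blinfun = id_blinfun"
  by (rule cadjoint_eqI) (simp_all add: bounded_ops_id)

lemma cadjoint_compose:
  "S \<in> bounded_ops \<Longrightarrow> T \<in> bounded_ops \<Longrightarrow> cadjoint (S o\<^sub>L T) = cadjoint T o\<^sub>L cadjoint S"
  by (rule cadjoint_eqI) (simp_all add: bounded_ops_compose cinner_cadjoint)

lemma cadjoint_add:
  "S \<in> bounded_ops \<Longrightarrow> T \<in> bounded_ops \<Longrightarrow> cadjoint (S + T) = cadjoint S + cadjoint T"
  by (rule cadjoint_eqI)
    (simp_all add: bounded_ops_add cinner_cadjoint blinfun.bilinear_simps cinner_add_left
      cinner_add_right)

lemma cadjoint_diff:
  "S \<in> bounded_ops \<Longrightarrow> T \<in> bounded_ops \<Longrightarrow> cadjoint (S - T) = cadjoint S - cadjoint T"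
  by (rule cadjoint_eqI)
    (simp_all add: bounded_ops_diff cinner_cadjoint blinfun.bilinear_simps cinner_diff_left
      cinner_diff_right)

lemma cadjoint_scaleR: "T \<in> bounded_ops \<Longrightarrow> cadjoint (r *\<^sub>R T) = r *\<^sub>R cadjoint T"
  by (rule cadjoint_eqI)
    (simp_all add: bounded_ops_scaleR cinner_cadjoint blinfun.bilinear_simps cinner_scaleR_left
      cinner_scaleR_right)

lemma commutantI:
  fixes A :: "('h::chilbert_space \<Rightarrow>\<^sub>L 'h) set"
  assumes "T \<in> bounded_ops" and "\<And>S x. S \<in> A \<Longrightarrow> T (S x) = S (T x)"
  shows "T \<in> commutant A"
  using assms by (auto simp: commutant_def intro!: blinfun_eqI)

lemma commutantD: "T \<in> commutant A \<Longrightarrow> S \<in> A \<Longrightarrow> T (S x) = S (T x)"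
  unfolding commutant_def by (metis (mono_tags, lifting) blinfun_apply_blinfun_compose mem_Collect_eq)

lemma commutant_bounded: "commutant A \<subseteq> bounded_ops"
  by (auto simp: commutant_def)

lemma commutant_antimono: "A \<subseteq> B \<Longrightarrow> commutant B \<subseteq> commutant A"
  by (auto simp: commutant_def)

lemma subset_double_commutant: "A \<subseteq> bounded_ops \<Longrightarrow> A \<subseteq> commutant (commutant A)"
  by (auto simp: commutant_def)

lemma vn_bounded: "von_neumann_algebra M \<Longrightarrow> T \<in> M \<Longrightarrow> T \<in> bounded_ops"
  by (auto simp: von_neumann_algebra_def)

lemma vn_memI:
  fixes M :: "('h::chilbert_space \<Rightarrow>\<^sub>L 'h) set"
  assumes "von_neumann_algebra M" "T \<in> bounded_ops"
    and "\<And>S x. S \<in> commutant M \<Longrightarrow> T (S x) = S (T x)"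
  shows "T \<in> M"
  using assms commutantI[of T "commutant M"] by (auto simp: von_neumann_algebra_def)

lemma vn_closed:
  assumes M: "von_neumann_algebra M"
  shows vn_id: "id_blinfun \<in> M"
    and vn_cadjoint: "T \<in> M \<Longrightarrow> cadjoint T \<in> M"
    and vn_compose: "S \<in> M \<Longrightarrow> T \<in> M \<Longrightarrow> S o\<^sub>L T \<in> M"
    and vn_add: "S \<in> M \<Longrightarrow> T \<in> M \<Longrightarrow> S + T \<in> M"
    and vn_diff: "S \<in> M \<Longrightarrow> T \<in> M \<Longrightarrow> S - T \<in> M"
    and vn_scaleR: "T \<in> M \<Longrightarrow> r *\<^sub>R T \<in> M"
proof -
  show "T \<in> M \<Longrightarrow> cadjoint T \<in> M" using M by (simp add: von_neumann_algebra_def)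
qed (rule vn_memI[OF M];
  simp add: bounded_ops_closed vn_bounded[OF M] blinfun.bilinear_simps commutantD commutantD[symmetric])+

lemma vn_commutant:
  assumes "A \<subseteq> bounded_ops" and "\<And>T. T \<in> A \<Longrightarrow> cadjoint T \<in> A"
  shows "von_neumann_algebra (commutant A)"
  unfolding von_neumann_algebra_def
proof (intro conjI ballI)
  fix T assume T: "T \<in> commutant A"
  then have Tb: "T \<in> bounded_ops" using commutant_bounded by blast
  show "cadjoint T \<in> commutant A"
  proof (rule commutantI)
    fix S x assume S: "S \<in> A"
    then have Sb: "S \<in> bounded_ops" using assms by blast
    have "T (cadjoint S y) = cadjoint S (T y)" for y
      by (rule commutantD[OF T assms(2)[OF S]])
    then show "cadjoint T (S x) = S (cadjoint T x)"
      by (intro cinner_ext) (metis cinner_cadjoint[OF Tb] cinner_cadjoint_right[OF Sb])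
  qed (rule cadjoint_in_bounded_ops[OF Tb])
next
  show "commutant (commutant (commutant A)) = commutant A"
    by (intro equalityI commutant_antimono subset_double_commutant assms commutant_bounded)
qed (rule commutant_bounded)

lemma vn_bounded_ops: "von_neumann_algebra bounded_ops"
  unfolding von_neumann_algebra_def
  by (simp add: cadjoint_in_bounded_ops subset_double_commutant commutant_bounded equalityI)

lemma vn_vn_generated:
  assumes "A \<subseteq> bounded_ops"
  shows "von_neumann_algebra (vn_generated A)"
proof -
  have gen: "vn_generated A \<subseteq> R" if "von_neumann_algebra R" "A \<subseteq> R" for R
    using that by (auto simp: vn_generated_def)
  have b: "vn_generated A \<subseteq> bounded_ops" by (rule gen[OF vn_bounded_ops assms])
  have "commutant (commutant (vn_generated A)) \<subseteq> R" if "von_neumann_algebra R" "A \<subseteq> R" for R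
    using commutant_antimono[OF commutant_antimono[OF gen[OF that]]] that(1)
    by (simp add: von_neumann_algebra_def)
  then have "commutant (commutant (vn_generated A)) \<subseteq> vn_generated A"
    by (auto simp: vn_generated_def)
  moreover have "cadjoint T \<in> vn_generated A" if "T \<in> vn_generated A" for T
    using that by (auto simp: vn_generated_def vn_cadjoint)
  ultimately show ?thesis
    using b subset_double_commutant[OF b] by (auto simp: von_neumann_algebra_def)
qed

text \<open>
  Complex scalar multiplication as an operator; it turns a skew-adjoint operator into a
  self-adjoint one.
\<close>

definition scalar_op :: "complex \<Rightarrow> 'h::chilbert_space \<Rightarrow>\<^sub>L 'h" where
  "scalar_op c = Blinfun ((*\<^sub>C) c)"

lemma scalar_op_apply [simp]: "scalar_op c x = c *\<^sub>C x"
  by (simp add: scalar_op_def bounded_linear_Blinfun_apply bounded_linear_scaleC_right)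

lemma scalar_op_bounded: "scalar_op c \<in> bounded_ops"
  by (simp add: bounded_ops_def scaleC_scaleC mult.commute)

lemma vn_scalar_op:
  assumes "von_neumann_algebra M"
  shows "scalar_op c \<in> M"
proof (rule vn_memI[OF assms])
  show "scalar_op c (S x) = S (scalar_op c x)" if "S \<in> commutant M" for S x
    using that commutant_bounded[of M] by (auto simp: bounded_opsD)
qed (rule scalar_op_bounded)

lemma cadjoint_scalar_op: "cadjoint (scalar_op c) = scalar_op (cnj c)"
  by (rule cadjoint_eqI)
    (simp_all add: scalar_op_bounded cinner_scaleC_left cinner_scaleC_right)

text \<open>
  $C$ commutes with $T$ if it commutes with the self-adjoint operators $T + T^*$ and $i(T - T^*)$.
\<close>

lemma commutes_cartesian:
  fixes C T :: "'h::chilbert_space \<Rightarrow>\<^sub>L 'h"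
  assumes C: "C \<in> bounded_ops"
    and re: "\<And>x. C ((T + cadjoint T) x) = (T + cadjoint T) (C x)"
    and im: "\<And>x. C ((scalar_op \<i> o\<^sub>L (T - cadjoint T)) x) = (scalar_op \<i> o\<^sub>L (T - cadjoint T)) (C x)"
  shows "C (T x) = T (C x)"
proof -
  have "\<i> *\<^sub>C C ((T - cadjoint T) x) = \<i> *\<^sub>C (T - cadjoint T) (C x)"
    using im[of x] by (simp add: bounded_opsD[OF C])
  then have "(- \<i>) *\<^sub>C \<i> *\<^sub>C C ((T - cadjoint T) x) = (- \<i>) *\<^sub>C \<i> *\<^sub>C (T - cadjoint T) (C x)"
    by (rule arg_cong)
  then have "C (T x) - C (cadjoint T x) = T (C x) - cadjoint T (C x)"
    by (simp add: scaleC_scaleC blinfun.bilinear_simps)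
  moreover have "C (T x) + C (cadjoint T x) = T (C x) + cadjoint T (C x)"
    using re[of x] by (simp add: blinfun.bilinear_simps)
  ultimately have "(C (T x) - C (cadjoint T x)) + (C (T x) + C (cadjoint T x)) =
      (T (C x) - cadjoint T (C x)) + (T (C x) + cadjoint T (C x))"
    by (rule arg_cong2)
  then have "2 *\<^sub>R C (T x) = 2 *\<^sub>R T (C x)"
    by (simp add: scaleR_2)
  then show ?thesis by simp
qed

lemma cartesian_self_adjoint:
  assumes "T \<in> bounded_ops"
  shows "cadjoint (T + cadjoint T) = T + cadjoint T"
    and "cadjoint (scalar_op \<i> o\<^sub>L (T - cadjoint T)) = scalar_op \<i> o\<^sub>L (T - cadjoint T)"
proof -
  show "cadjoint (T + cadjoint T) = T + cadjoint T"
    using assms by (simp add: cadjoint_add cadjoint_in_bounded_ops cadjoint_cadjoint add.commute)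
  have D: "T - cadjoint T \<in> bounded_ops"
    by (intro bounded_ops_diff assms cadjoint_in_bounded_ops)
  have "cadjoint (scalar_op \<i> o\<^sub>L (T - cadjoint T)) = (cadjoint T - T) o\<^sub>L scalar_op (- \<i>)"
    using assms D by (simp add: cadjoint_compose scalar_op_bounded cadjoint_scalar_op cadjoint_diff
        cadjoint_in_bounded_ops cadjoint_cadjoint)
  also have "\<dots> = scalar_op \<i> o\<^sub>L (T - cadjoint T)"
  proof (rule blinfun_eqI)
    show "((cadjoint T - T) o\<^sub>L scalar_op (- \<i>)) x = (scalar_op \<i> o\<^sub>L (T - cadjoint T)) x" for x
    proof -
      have "(- \<i>) *\<^sub>C (cadjoint T x - T x) = \<i> *\<^sub>C (T x - cadjoint T x)"
        using scaleC_scaleC[of \<i> "-1" "cadjoint T x - T x"] scaleC_of_real[of "-1" "cadjoint T x - T x"]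
        by simp
      then show ?thesis
        using assms
        by (simp add: bounded_opsD[OF assms] bounded_opsD[OF cadjoint_in_bounded_ops[OF assms]]
            blinfun.bilinear_simps scaleC_diff_right)
    qed
  qed
  finally show "cadjoint (scalar_op \<i> o\<^sub>L (T - cadjoint T)) = scalar_op \<i> o\<^sub>L (T - cadjoint T)" .
qed

text \<open>
  A MASA equals its relative commutant: a self-adjoint $H \in N' \cap M$ generates together with
  $N$ an abelian von Neumann subalgebra of $M$. A general $T$ is reduced to this case through the
  self-adjoint operators $T + T^*$ and $i(T - T^*)$.
\<close>

lemma masa_contains_relative_commutant:
  fixes M N :: "('h::chilbert_space \<Rightarrow>\<^sub>L 'h) set"
  assumes "masa N M" "T \<in> M" and comm: "\<And>S x. S \<in> N \<Longrightarrow> T (S x) = S (T x)"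
  shows "T \<in> N"
proof -
  from assms(1) have N: "von_neumann_algebra N" and M: "von_neumann_algebra M" and "N \<subseteq> M"
    and ab: "abelian N"
    and max: "\<And>A. vn_subalgebra A M \<Longrightarrow> abelian A \<Longrightarrow> N \<subseteq> A \<Longrightarrow> A = N"
    by (auto simp: masa_def vn_subalgebra_def)
  have sa: "H \<in> N" if H: "H \<in> M" "cadjoint H = H" "\<And>S x. S \<in> N \<Longrightarrow> H (S x) = S (H x)" for H
  proof -
    define A where "A = insert H N"
    have A: "A \<subseteq> bounded_ops" "\<And>T. T \<in> A \<Longrightarrow> cadjoint T \<in> A"
      using H vn_bounded[OF M] vn_bounded[OF N] vn_cadjoint[OF N] by (auto simp: A_def)
    \<comment> \<open>A commutative set lies in its commutant, so its bicommutant is commutative.\<close>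
    have sub: "A \<subseteq> commutant A"
    proof
      fix X assume X: "X \<in> A"
      have "S (T x) = T (S x)" if "S \<in> N" "T \<in> N" for S T x
        using ab that unfolding abelian_def
        by (metis blinfun_apply_blinfun_compose)
      then show "X \<in> commutant A"
        using X H(3) A(1) by (intro commutantI) (auto simp: A_def)
    qed
    have cA: "von_neumann_algebra (commutant A)" by (rule vn_commutant[OF A])
    then have vA: "von_neumann_algebra (commutant (commutant A))"
      by (intro vn_commutant) (auto intro: vn_cadjoint vn_bounded)
    have "commutant (commutant A) \<subseteq> commutant A" by (rule commutant_antimono[OF sub])
    then have "abelian (commutant (commutant A))"
      unfolding abelian_def by (auto simp: commutant_def)
    moreover have "commutant (commutant A) \<subseteq> commutant (commutant M)"
      using H(1) \<open>N \<subseteq> M\<close> by (intro commutant_antimono) (auto simp: A_def)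
    then have "vn_subalgebra (commutant (commutant A)) M"
      using vA M by (simp add: vn_subalgebra_def von_neumann_algebra_def)
    ultimately have "commutant (commutant A) = N"
      using subset_double_commutant[OF A(1)] by (intro max) (auto simp: A_def)
    then show ?thesis using subset_double_commutant[OF A(1)] by (auto simp: A_def)
  qed
  have T: "T \<in> bounded_ops" using vn_bounded M assms(2) by blast
  have commT: "cadjoint T (S x) = S (cadjoint T x)" if "S \<in> N" for S x
  proof (rule cinner_ext)
    have S: "S \<in> bounded_ops" "cadjoint S \<in> N" using that N vn_bounded vn_cadjoint by blast+
    show "cinner (cadjoint T (S x)) y = cinner (S (cadjoint T x)) y" for y
    proof -
      have "cinner (cadjoint T (S x)) y = cinner x (cadjoint S (T y))"
        by (simp add: cinner_cadjoint[OF T] cinner_cadjoint_right[OF S(1)])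
      also have "\<dots> = cinner x (T (cadjoint S y))" by (simp add: comm[OF S(2)])
      also have "\<dots> = cinner (S (cadjoint T x)) y"
        by (metis cinner_cadjoint[OF T] cinner_cadjoint_right[OF S(1)])
      finally show ?thesis .
    qed
  qed
  have Sb: "S (c *\<^sub>C x) = c *\<^sub>C S x" if "S \<in> N" for S c x
    using vn_bounded[OF N that] by (rule bounded_opsD)
  have TM: "T + cadjoint T \<in> M" "scalar_op \<i> o\<^sub>L (T - cadjoint T) \<in> M"
    by (intro vn_add[OF M] vn_diff[OF M] vn_compose[OF M] vn_scalar_op[OF M] assms(2)
        vn_cadjoint[OF M])+
  have "T + cadjoint T \<in> N"
    by (rule sa[OF TM(1) cartesian_self_adjoint(1)[OF T]])
      (simp add: blinfun.bilinear_simps comm commT)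
  moreover have "scalar_op \<i> o\<^sub>L (T - cadjoint T) \<in> N"
    by (rule sa[OF TM(2) cartesian_self_adjoint(2)[OF T]])
      (simp add: blinfun.bilinear_simps comm commT Sb)
  ultimately show "T \<in> N"
  proof (intro vn_memI[OF N T])
    fix C x assume C: "C \<in> commutant N"
    then have "C \<in> bounded_ops" using commutant_bounded by blast
    assume p: "T + cadjoint T \<in> N" "scalar_op \<i> o\<^sub>L (T - cadjoint T) \<in> N"
    show "T (C x) = C (T x)"
      by (rule sym, rule commutes_cartesian[OF \<open>C \<in> bounded_ops\<close>])
        (rule commutantD[OF C p(1)], rule commutantD[OF C p(2)])
  qed
qed

section \<open>Square roots and polar decomposition\<close>

lemma bounded_ops_zero: "0 \<in> bounded_ops"
  by (simp add: bounded_ops_def)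

lemma self_adjoint_inner:
  assumes "T \<in> bounded_ops" "cadjoint T = T"
  shows "inner (T x) y = inner x (T y)"
  using cinner_cadjoint[OF assms(1), of x y] by (simp only: assms(2) inner_eq_Re_cinner)

lemma inner_cadjoint:
  assumes "T \<in> bounded_ops"
  shows "inner (cadjoint T x) y = inner x (T y)"
  by (simp only: cinner_cadjoint[OF assms] inner_eq_Re_cinner)

lemma inner_ext: "(\<And>y. inner u y = inner v y) \<Longrightarrow> u = v"
  using vector_eq_rdot[of u v] by blast

lemma cadjoint_eqI_inner:
  fixes S T :: "'h::chilbert_space \<Rightarrow>\<^sub>L 'h"
  assumes "T \<in> bounded_ops" and "\<And>x y. inner (S x) y = inner x (T y)"
  shows "cadjoint T = S"
proof (rule blinfun_eqI)
  show "cadjoint T x = S x" for x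
    by (rule inner_ext) (simp only: inner_cadjoint[OF assms(1)] assms(2))
qed

lemma bounded_ops_limit:
  fixes V :: "'h::chilbert_space \<Rightarrow>\<^sub>L 'h"
  assumes "\<And>n. X n \<in> bounded_ops" and "\<And>x. (\<lambda>n. X n x) \<longlonglongrightarrow> V x"
  shows "V \<in> bounded_ops"
  unfolding bounded_ops_def
proof (intro CollectI allI)
  fix c x
  have "(\<lambda>n. c *\<^sub>C X n x) \<longlonglongrightarrow> c *\<^sub>C V x"
    by (rule bounded_linear.tendsto[OF bounded_linear_scaleC_right assms(2)])
  then have "(\<lambda>n. X n (c *\<^sub>C x)) \<longlonglongrightarrow> c *\<^sub>C V x"
    using assms(1) by (simp add: bounded_opsD)
  then show "V (c *\<^sub>C x) = c *\<^sub>C V x"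
    by (rule LIMSEQ_unique[OF assms(2)])
qed

lemma vn_limit:
  fixes V :: "'h::chilbert_space \<Rightarrow>\<^sub>L 'h"
  assumes M: "von_neumann_algebra M"
    and X: "\<And>n. X n \<in> M" "\<And>x. (\<lambda>n. X n x) \<longlonglongrightarrow> V x"
  shows "V \<in> M"
proof (rule vn_memI[OF M])
  show "V \<in> bounded_ops"
    by (rule bounded_ops_limit[of X]) (simp_all add: vn_bounded[OF M] X)
  fix C x assume C: "C \<in> commutant M"
  have "(\<lambda>n. C (X n x)) \<longlonglongrightarrow> C (V x)" by (intro tendsto_intros X)
  moreover have "C (X n x) = X n (C x)" for n by (rule commutantD[OF C X(1)])
  ultimately show "V (C x) = C (V x)" using LIMSEQ_unique[OF X(2)] by simp
qed

lemma vn_bicommutant_singleton: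
  assumes "von_neumann_algebra M" "T \<in> M"
  shows "commutant (commutant {T}) \<subseteq> M"
proof -
  have "commutant (commutant {T}) \<subseteq> commutant (commutant M)"
    using assms(2) by (intro commutant_antimono) simp
  then show ?thesis using assms(1) by (simp add: von_neumann_algebra_def)
qed

lemma commutant_singletonD:
  fixes T :: "'h::chilbert_space \<Rightarrow>\<^sub>L 'h"
  shows "C \<in> commutant {T} \<Longrightarrow> C (T x) = T (C x)"
  by (erule commutantD) simp

text \<open>
  The iteration $Y_{n+1} = (B + Y_n^2)/2$, whose limit $Y$ satisfies $(1-Y)^2 = 1-B$. If
  $\|B\| \le 1$, then the increments of $Y_n$ are dominated in norm by those of the same
  iteration for the number $1$ in place of $B$, which increases and is bounded by $1$.
\<close>

primrec sqrt_iter :: "('h::chilbert_space \<Rightarrow>\<^sub>L 'h) \<Rightarrow> nat \<Rightarrow> ('h \<Rightarrow>\<^sub>L 'h)" where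
  "sqrt_iter B 0 = 0"
| "sqrt_iter B (Suc n) = (1/2) *\<^sub>R (B + (sqrt_iter B n o\<^sub>L sqrt_iter B n))"

primrec sqrt_majorant :: "nat \<Rightarrow> real" where
  "sqrt_majorant 0 = 0"
| "sqrt_majorant (Suc n) = (1 + (sqrt_majorant n)\<^sup>2) / 2"

lemma sqrt_majorant_bounds: "0 \<le> sqrt_majorant n" "sqrt_majorant n \<le> 1"
proof -
  have "0 \<le> sqrt_majorant n \<and> sqrt_majorant n \<le> 1"
    by (induction n) (auto simp: power_le_one)
  then show "0 \<le> sqrt_majorant n" "sqrt_majorant n \<le> 1" by auto
qed

lemma sqrt_majorant_incseq: "incseq sqrt_majorant"
proof (rule incseq_SucI)
  fix n
  show "sqrt_majorant n \<le> sqrt_majorant (Suc n)"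
    using zero_le_power2[of "1 - sqrt_majorant n"] by (simp add: power2_diff)
qed

lemma norm_sqrt_iter_le:
  assumes "norm B \<le> 1"
  shows "norm (sqrt_iter B n) \<le> sqrt_majorant n"
proof (induction n)
  case (Suc n)
  have "norm (sqrt_iter B n o\<^sub>L sqrt_iter B n) \<le> norm (sqrt_iter B n) * norm (sqrt_iter B n)"
    by (rule norm_blinfun_compose)
  also have "\<dots> \<le> (sqrt_majorant n)\<^sup>2"
    unfolding power2_eq_square by (intro mult_mono Suc) (simp_all add: sqrt_majorant_bounds)
  finally have "norm (sqrt_iter B n o\<^sub>L sqrt_iter B n) \<le> (sqrt_majorant n)\<^sup>2" .
  then show ?case
    using norm_triangle_ineq[of B "sqrt_iter B n o\<^sub>L sqrt_iter B n"] assms by simp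
qed simp

lemma norm_sqrt_iter_Suc_diff_le:
  assumes "norm B \<le> 1"
  shows "norm (sqrt_iter B (Suc n) - sqrt_iter B n) \<le> sqrt_majorant (Suc n) - sqrt_majorant n"
proof (induction n)
  case 0
  then show ?case using assms by simp
next
  case (Suc n)
  let ?X = "sqrt_iter B (Suc n)" and ?Y = "sqrt_iter B n"
  let ?x = "sqrt_majorant (Suc n)" and ?y = "sqrt_majorant n"
  have "sqrt_iter B (Suc (Suc n)) - ?X = (1/2) *\<^sub>R ((?X o\<^sub>L (?X - ?Y)) + ((?X - ?Y) o\<^sub>L ?Y))"
    by (subst (1 2) sqrt_iter.simps(2))
      (rule blinfun_eqI, simp add: blinfun.bilinear_simps scaleR_diff_right[symmetric] del: sqrt_iter.simps)
  then have "norm (sqrt_iter B (Suc (Suc n)) - ?X)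
      = norm ((?X o\<^sub>L (?X - ?Y)) + ((?X - ?Y) o\<^sub>L ?Y)) / 2"
    by simp
  also have "\<dots> \<le> (norm (?X o\<^sub>L (?X - ?Y)) + norm ((?X - ?Y) o\<^sub>L ?Y)) / 2"
    by (intro divide_right_mono norm_triangle_ineq) simp
  also have "\<dots> \<le> (norm ?X * norm (?X - ?Y) + norm (?X - ?Y) * norm ?Y) / 2"
    by (intro divide_right_mono add_mono norm_blinfun_compose) simp
  also have "\<dots> \<le> (?x * (?x - ?y) + (?x - ?y) * ?y) / 2"
    by (intro divide_right_mono add_mono mult_mono norm_sqrt_iter_le assms Suc.IH)
      (use sqrt_majorant_bounds sqrt_majorant_incseq[THEN incseq_SucD, of n] in
        \<open>auto simp del: sqrt_majorant.simps(2)\<close>)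
  also have "\<dots> = sqrt_majorant (Suc (Suc n)) - ?x"
    by (simp add: power2_eq_square field_simps)
  finally show ?case .
qed

lemma sqrt_iter_convergent:
  assumes "norm B \<le> 1"
  shows "convergent (sqrt_iter B)"
proof -
  have diff: "norm (sqrt_iter B n - sqrt_iter B m) \<le> sqrt_majorant n - sqrt_majorant m"
    if "m \<le> n" for m n
    using that
  proof (induction n rule: dec_induct)
    case (step n)
    then show ?case
      using norm_triangle_ineq[of "sqrt_iter B (Suc n) - sqrt_iter B n" "sqrt_iter B n - sqrt_iter B m"]
        norm_sqrt_iter_Suc_diff_le[OF assms, of n]
      by (simp del: sqrt_iter.simps sqrt_majorant.simps)
  qed simp
  obtain l where "sqrt_majorant \<longlonglongrightarrow> l"
    by (rule incseq_convergent[OF sqrt_majorant_incseq, of 1]) (auto simp: sqrt_majorant_bounds)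
  then have "Cauchy sqrt_majorant" by (rule LIMSEQ_imp_Cauchy)
  have "Cauchy (sqrt_iter B)"
  proof (rule metric_CauchyI)
    fix e :: real assume "e > 0"
    then obtain N where N: "\<And>m n. m \<ge> N \<Longrightarrow> n \<ge> N \<Longrightarrow> dist (sqrt_majorant m) (sqrt_majorant n) < e"
      using \<open>Cauchy sqrt_majorant\<close> by (meson metric_CauchyD)
    have le: "dist (sqrt_iter B m) (sqrt_iter B n) \<le> dist (sqrt_majorant m) (sqrt_majorant n)" for m n
    proof (cases "m \<le> n")
      case True
      then show ?thesis
        using diff[OF True] by (simp add: dist_norm norm_minus_commute abs_if)
    next
      case False
      then show ?thesis using diff[of n m] by (simp add: dist_norm abs_if)
    qed
    show "\<exists>M. \<forall>m\<ge>M. \<forall>n\<ge>M. dist (sqrt_iter B m) (sqrt_iter B n) < e"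
      using N le by (meson le_less_trans)
  qed
  then show ?thesis by (rule Cauchy_convergent)
qed

lemma sqrt_one_minus:
  fixes B :: "'h::chilbert_space \<Rightarrow>\<^sub>L 'h"
  assumes B: "B \<in> bounded_ops" "cadjoint B = B" "norm B \<le> 1"
  obtains Y where "Y \<in> bounded_ops" "cadjoint Y = Y" "norm Y \<le> 1"
    "\<And>x. Y x + Y x = B x + Y (Y x)"
    "Y \<in> commutant (commutant {B})"
proof -
  obtain Y where lim: "sqrt_iter B \<longlonglongrightarrow> Y"
    using sqrt_iter_convergent[OF B(3)] by (auto simp: convergent_def)
  have limx: "(\<lambda>n. sqrt_iter B n x) \<longlonglongrightarrow> Y x" for x
    by (intro tendsto_intros lim)
  have Bn: "sqrt_iter B n \<in> bounded_ops" for n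
    by (induction n) (simp_all add: bounded_ops_closed bounded_ops_zero B)
  have sa: "inner (sqrt_iter B n x) y = inner x (sqrt_iter B n y)" for n x y
    by (induction n arbitrary: x y)
      (simp_all add: blinfun.bilinear_simps inner_add_left inner_add_right self_adjoint_inner[OF B(1,2)])
  show thesis
  proof
    show YB: "Y \<in> bounded_ops" by (rule bounded_ops_limit[OF Bn limx])
    show "cadjoint Y = Y"
    proof (rule cadjoint_eqI_inner[OF YB])
      show "inner (Y x) y = inner x (Y y)" for x y
      proof (rule LIMSEQ_unique)
        show "(\<lambda>n. inner (sqrt_iter B n x) y) \<longlonglongrightarrow> inner (Y x) y" by (intro tendsto_intros limx)
        show "(\<lambda>n. inner (sqrt_iter B n x) y) \<longlonglongrightarrow> inner x (Y y)"
          unfolding sa by (intro tendsto_intros limx)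
      qed
    qed
    show "norm Y \<le> 1"
      using norm_sqrt_iter_le[OF B(3)] sqrt_majorant_bounds(2)
      by (intro LIMSEQ_le_const2[OF tendsto_norm[OF lim]]) (meson order_trans)
    have "Y = (1/2) *\<^sub>R (B + (Y o\<^sub>L Y))"
    proof (rule LIMSEQ_unique)
      show "(\<lambda>n. sqrt_iter B (Suc n)) \<longlonglongrightarrow> Y" by (rule LIMSEQ_Suc[OF lim])
      show "(\<lambda>n. sqrt_iter B (Suc n)) \<longlonglongrightarrow> (1/2) *\<^sub>R (B + (Y o\<^sub>L Y))"
        unfolding sqrt_iter.simps
        by (intro tendsto_intros bounded_bilinear.tendsto[OF bounded_bilinear_blinfun_compose] lim)
    qed
    then have "Y x = ((1/2) *\<^sub>R (B + (Y o\<^sub>L Y))) x" for x by simp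
    then have "Y x = (1/2) *\<^sub>R (B x + Y (Y x))" for x by (simp add: blinfun.bilinear_simps)
    then show "Y x + Y x = B x + Y (Y x)" for x
      by (metis scaleR_half_double scaleR_right_distrib)
    show "Y \<in> commutant (commutant {B})"
    proof (rule commutantI[OF YB])
      fix C x assume "C \<in> commutant {B}"
      then have com: "C (sqrt_iter B n x) = sqrt_iter B n (C x)" for n x
        by (induction n arbitrary: x) (simp_all add: blinfun.bilinear_simps commutant_singletonD)
      show "Y (C x) = C (Y x)"
      proof (rule LIMSEQ_unique)
        show "(\<lambda>n. C (sqrt_iter B n x)) \<longlonglongrightarrow> C (Y x)" by (intro tendsto_intros limx)
        show "(\<lambda>n. C (sqrt_iter B n x)) \<longlonglongrightarrow> Y (C x)"
          unfolding com by (rule limx)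
      qed
    qed
  qed
qed

lemma norm_cadjoint_apply_le:
  assumes "a \<in> bounded_ops"
  shows "norm (cadjoint a x) \<le> norm a * norm x"
proof -
  have "(norm (cadjoint a x))\<^sup>2 = inner x (a (cadjoint a x))"
    by (simp add: power2_norm_eq_inner inner_cadjoint[OF assms])
  also have "\<dots> \<le> norm x * (norm a * norm (cadjoint a x))"
    by (intro order_trans[OF norm_cauchy_schwarz] mult_left_mono norm_blinfun) simp
  finally show ?thesis
    by (cases "norm (cadjoint a x) = 0") (auto simp: power2_eq_square mult_ac)
qed

text \<open>The geometric sums $\sum_{j<n} Y^j$.\<close>

primrec geom :: "('h::chilbert_space \<Rightarrow>\<^sub>L 'h) \<Rightarrow> nat \<Rightarrow> ('h \<Rightarrow>\<^sub>L 'h)" where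
  "geom Y 0 = 0"
| "geom Y (Suc n) = id_blinfun + (Y o\<^sub>L geom Y n)"

text \<open>
  The powers of an operator $0 \le Y \le 1$ converge strongly: the numbers
  $\langle Y^n x, x\rangle$ decrease, and
  $\|Y^m x - Y^n x\|^2 = \langle (Y^{2m} - 2Y^{m+n} + Y^{2n})x, x\rangle$.
\<close>

lemma power_contraction_convergent:
  fixes Y :: "'h::chilbert_space \<Rightarrow>\<^sub>L 'h"
  assumes sa: "\<And>x y. inner (Y x) y = inner x (Y y)"
    and pos: "\<And>x. 0 \<le> inner (Y x) x" and contr: "\<And>x. inner (Y x) x \<le> inner x x"
  shows "(norm (Y x))\<^sup>2 \<le> inner (Y x) x" "convergent (\<lambda>n. (blinfun_apply Y ^^ n) x)"
proof -
  let ?f = "blinfun_apply Y"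
  define t where "t n = inner ((?f ^^ n) x) x" for n
  have pw: "inner ((?f ^^ m) x) ((?f ^^ n) y) = inner ((?f ^^ (m + n)) x) y" for m n x y
  proof (induction n arbitrary: m)
    case (Suc n)
    have "inner ((?f ^^ m) x) ((?f ^^ Suc n) y) = inner ((?f ^^ Suc m) x) ((?f ^^ n) y)"
      by (simp add: sa)
    then show ?case using Suc.IH[of "Suc m"] by simp
  qed simp
  have odd_pos: "(norm (Y x))\<^sup>2 \<le> inner (Y x) x" for x
  proof -
    \<comment> \<open>This is the identity $Y - Y^2 = Y(1-Y)Y + (1-Y)Y(1-Y)$.\<close>
    have "inner (Y (Y x)) (Y x) \<le> inner (Y x) (Y x)" by (rule contr)
    moreover have "0 \<le> inner (Y (x - Y x)) (x - Y x)" by (rule pos)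
    ultimately show ?thesis
      by (simp add: power2_norm_eq_inner blinfun.bilinear_simps inner_diff_left inner_diff_right sa)
  qed
  then show "(norm (Y x))\<^sup>2 \<le> inner (Y x) x" .
  have even: "t (2 * i) = inner ((?f ^^ i) x) ((?f ^^ i) x)" for i
    using pw[of i x i x] by (simp add: t_def mult_2)
  have odd: "t (Suc (2 * i)) = inner (Y ((?f ^^ i) x)) ((?f ^^ i) x)" for i
    using pw[of "Suc i" x i x] by (simp add: t_def mult_2)
  have dec: "t (Suc n) \<le> t n" for n
  proof (cases "even n")
    case True
    then obtain i where "n = 2 * i" by blast
    then show ?thesis using contr[of "(?f ^^ i) x"] by (simp add: even odd)
  next
    case False
    then obtain i where i: "n = Suc (2 * i)" by (auto elim: oddE)
    then have "Suc n = 2 * Suc i" by simp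
    then have "t (Suc n) = inner ((?f ^^ Suc i) x) ((?f ^^ Suc i) x)" by (metis even)
    then show ?thesis using odd_pos[of "(?f ^^ i) x"] by (simp add: i odd power2_norm_eq_inner)
  qed
  have "0 \<le> t n" for n
    by (cases "even n") (auto elim!: evenE oddE simp: even odd pos)
  moreover have "decseq t" using dec by (simp add: decseq_Suc_iff)
  ultimately obtain l where "t \<longlonglongrightarrow> l"
    using decseq_convergent[of t 0] by metis
  then have C: "Cauchy (\<lambda>n. t n)" by (rule LIMSEQ_imp_Cauchy)
  have sq: "(norm ((?f ^^ m) x - (?f ^^ n) x))\<^sup>2
      = (t (2 * m) - t (m + n)) + (t (2 * n) - t (m + n))" for m n
  proof -
    have "inner ((?f ^^ i) x) ((?f ^^ j) x) = t (i + j)" for i j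
      by (simp only: pw t_def)
    then show ?thesis
      unfolding power2_norm_eq_inner inner_diff_left inner_diff_right mult_2 by (simp only: add.commute)
  qed
  have "Cauchy (\<lambda>n. (?f ^^ n) x)"
  proof (rule metric_CauchyI)
    fix e :: real assume "e > 0"
    then obtain N where N: "\<And>m n. m \<ge> N \<Longrightarrow> n \<ge> N \<Longrightarrow> dist (t m) (t n) < e\<^sup>2 / 2"
      using metric_CauchyD[OF C, of "e\<^sup>2/2"] by auto
    have "dist ((?f ^^ m) x) ((?f ^^ n) x) < e" if "m \<ge> N" "n \<ge> N" for m n
    proof -
      have "dist (t (2 * m)) (t (m + n)) < e\<^sup>2/2" "dist (t (2 * n)) (t (m + n)) < e\<^sup>2/2"
        using that by (intro N; simp)+
      then have "(norm ((?f ^^ m) x - (?f ^^ n) x))\<^sup>2 < e\<^sup>2"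
        unfolding sq dist_real_def by linarith
      then show ?thesis
        unfolding dist_norm by (rule power2_less_imp_less) (use \<open>e > 0\<close> in simp)
    qed
    then show "\<exists>M. \<forall>m\<ge>M. \<forall>n\<ge>M. dist ((?f ^^ m) x) ((?f ^^ n) x) < e" by blast
  qed
  then show "convergent (\<lambda>n. (?f ^^ n) x)" by (rule Cauchy_convergent)
qed

text \<open>
  The polar decomposition $a = VP$, where $P = (a^*a)^{1/2}$ and $V$ is a partial isometry. With
  $P = 1 - Y$ and $G_n = \sum_{j<n} Y^j$ one has $PG_n = 1 - Y^n$, so
  $\|a(G_m - G_n)x\| = \|(Y^m - Y^n)x\|$, and $V$ is the strong limit of the operators $aG_n$.
  Stating that $P$ and $G_n$ lie in the bicommutant of $a^*a$ places all factors in any von Neumann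
  algebra that contains $a$, and makes it possible to transfer algebraic relations from $a$ to $V$.
\<close>

lemma polar_decomposition:
  fixes a :: "'h::chilbert_space \<Rightarrow>\<^sub>L 'h"
  assumes a: "a \<in> bounded_ops" "norm a \<le> 1"
  obtains V P G where
    "V \<in> bounded_ops" "norm V \<le> 1" "P \<in> bounded_ops" "cadjoint P = P" "norm (2 *\<^sub>R P - id_blinfun) \<le> 1"
    "\<And>n::nat. G n \<in> bounded_ops" "\<And>n. cadjoint (G n) = G n"
    "\<And>x. (\<lambda>n. a (G n x)) \<longlonglongrightarrow> V x"
    "P \<in> commutant (commutant {cadjoint a o\<^sub>L a})"
    "\<And>n. G n \<in> commutant (commutant {cadjoint a o\<^sub>L a})"
    "\<And>x. V (P x) = a x" "\<And>x. V (cadjoint V (V x)) = V x" "\<And>x. a x = 0 \<longrightarrow> V x = 0"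
proof -
  define B where "B = id_blinfun - (cadjoint a o\<^sub>L a)"
  note a' = cadjoint_in_bounded_ops[OF a(1)]
  have Bx: "B x = x - cadjoint a (a x)" for x by (simp add: B_def blinfun.bilinear_simps)
  have B: "B \<in> bounded_ops" unfolding B_def by (intro bounded_ops_closed a a')
  have B': "cadjoint B = B"
    by (simp add: B_def cadjoint_diff cadjoint_compose bounded_ops_closed a a' cadjoint_id
        cadjoint_cadjoint)
  have "norm B \<le> 1"
  proof (rule norm_blinfun_bound)
    fix x
    have "norm (cadjoint a (a x)) \<le> norm (a x)"
      using norm_cadjoint_apply_le[OF a(1), of "a x"] a(2)
      by (meson mult_left_le_one_le norm_ge_zero order_trans)
    then have "(norm (cadjoint a (a x)))\<^sup>2 \<le> (norm (a x))\<^sup>2" by (intro power_mono) auto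
    moreover have "inner (cadjoint a (a x)) x = (norm (a x))\<^sup>2"
      by (simp add: inner_cadjoint[OF a(1)] power2_norm_eq_inner)
    moreover have "(norm (B x))\<^sup>2
        = (norm x)\<^sup>2 - 2 * inner (cadjoint a (a x)) x + (norm (cadjoint a (a x)))\<^sup>2"
      by (simp add: Bx power2_norm_eq_inner inner_diff_left inner_diff_right inner_commute)
    ultimately have "(norm (B x))\<^sup>2 \<le> (norm x)\<^sup>2"
      using zero_le_power2[of "norm (a x)"] by linarith
    then show "norm (B x) \<le> 1 * norm x" by (simp add: power2_le_iff_abs_le)
  qed simp
  from sqrt_one_minus[OF B B' this] obtain Y where Y: "Y \<in> bounded_ops" "cadjoint Y = Y" "norm Y \<le> 1"
    and YY: "\<And>x. Y x + Y x = B x + Y (Y x)"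
    and Ycom: "Y \<in> commutant (commutant {B})" by metis
  let ?f = "blinfun_apply Y"
  define P where "P = id_blinfun - Y"
  have Px: "P x = x - Y x" for x by (simp add: P_def blinfun.bilinear_simps)
  have P: "P \<in> bounded_ops" unfolding P_def by (intro bounded_ops_closed Y)
  have P': "cadjoint P = P" by (simp add: P_def cadjoint_diff bounded_ops_closed Y cadjoint_id)
  have PP: "P (P x) = cadjoint a (a x)" for x
    using YY[of x] by (simp add: Px blinfun.bilinear_simps Bx algebra_simps)
  note saY = self_adjoint_inner[OF Y(1,2)] and saP = self_adjoint_inner[OF P P']
  have aP: "inner (a x) (a y) = inner (P x) (P y)" for x y
    by (metis PP inner_cadjoint[OF a(1)] saP)
  then have nP: "norm (P x) = norm (a x)" for x by (simp add: norm_eq_sqrt_inner)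
  have contr_inner: "inner (T x) x \<le> inner x x" if "\<And>x. norm (T x) \<le> norm x" for T :: "'h \<Rightarrow>\<^sub>L 'h" and x
    using norm_cauchy_schwarz[of "T x" x] mult_right_mono[OF that[of x] norm_ge_zero[of x]]
    by (simp add: power2_norm_eq_inner[symmetric] power2_eq_square)
  have "norm (Y x) \<le> norm x" for x
    using norm_blinfun[of Y x] Y(3) by (meson mult_left_le_one_le norm_ge_zero order_trans)
  note cY = contr_inner[OF this]
  have "norm (P x) \<le> norm x" for x
    unfolding nP using norm_blinfun[of a x] a(2)
    by (meson mult_left_le_one_le norm_ge_zero order_trans)
  from contr_inner[OF this] have pY: "0 \<le> inner (Y x) x" for x
    by (simp add: Px inner_diff_left)
  note pc = power_contraction_convergent[OF saY pY cY]
  then obtain Q where Q: "\<And>x. (\<lambda>n. (?f ^^ n) x) \<longlonglongrightarrow> Q x"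
    unfolding convergent_def by metis
  have saYn: "inner ((?f ^^ n) x) y = inner x ((?f ^^ n) y)" for n x y
    by (induction n arbitrary: x y) (simp_all add: saY funpow_swap1)
  \<comment> \<open>The limit \<open>Q\<close> of the powers is the projection onto the kernel of \<open>P\<close>; \<open>V\<close> will
    satisfy $V^*V = 1 - Q$.\<close>
  have Q_sa: "inner (Q x) y = inner x (Q y)" for x y
  proof (rule LIMSEQ_unique)
    show "(\<lambda>n. inner ((?f ^^ n) x) y) \<longlonglongrightarrow> inner (Q x) y" by (intro tendsto_intros Q)
    show "(\<lambda>n. inner ((?f ^^ n) x) y) \<longlonglongrightarrow> inner x (Q y)"
      unfolding saYn by (intro tendsto_intros Q)
  qed
  have Q_inner: "inner (Q x) (Q y) = inner (Q x) y" for x y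
  proof (rule LIMSEQ_unique)
    show "(\<lambda>n. inner ((?f ^^ n) x) ((?f ^^ n) y)) \<longlonglongrightarrow> inner (Q x) (Q y)" by (intro tendsto_intros Q)
    have "inner ((?f ^^ n) x) ((?f ^^ n) y) = inner ((?f ^^ (2 * n)) x) y" for n
      by (simp add: saYn[symmetric] mult_2 funpow_add)
    moreover have "(\<lambda>n. (?f ^^ (2 * n)) x) \<longlonglongrightarrow> Q x"
      using LIMSEQ_subseq_LIMSEQ[OF Q, of "\<lambda>n. 2 * n"] by (simp add: strict_mono_def o_def)
    ultimately show "(\<lambda>n. inner ((?f ^^ n) x) ((?f ^^ n) y)) \<longlonglongrightarrow> inner (Q x) y"
      by (simp add: tendsto_intros)
  qed
  have QQ: "Q (Q x) = Q x" for x
    by (rule inner_ext) (metis Q_sa Q_inner)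
  define G where "G = geom Y"
  have G: "G n \<in> bounded_ops" for n
    by (induction n) (simp_all add: G_def bounded_ops_closed bounded_ops_zero Y)
  have GY: "G n (Y x) = Y (G n x)" for n x
    by (induction n) (simp_all add: G_def blinfun.bilinear_simps)
  have saG: "inner (G n x) y = inner x (G n y)" for n x y
  proof (induction n arbitrary: x y)
    case (Suc n)
    then show ?case using GY[of n y]
      by (simp add: G_def blinfun.bilinear_simps inner_add_left inner_add_right saY)
  qed (simp add: G_def)
  have PG: "P (G n x) = x - (?f ^^ n) x" for n x
  proof (induction n)
    case (Suc n)
    have "P (G (Suc n) x) = P x + Y (P (G n x))"
      by (simp add: G_def Px blinfun.bilinear_simps)
    then show ?case unfolding Suc.IH by (simp add: Px blinfun.bilinear_simps)
  qed (simp add: G_def)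
  have aG: "norm (a (G m x) - a (G n x)) = norm ((?f ^^ m) x - (?f ^^ n) x)" for m n x
  proof -
    have "norm (a (G m x - G n x)) = norm (P (G m x - G n x))" by (simp only: nP)
    then show ?thesis by (simp add: blinfun.bilinear_simps PG norm_minus_commute)
  qed
  have "convergent (\<lambda>n. a (G n x))" for x
  proof (rule Cauchy_convergent)
    have "Cauchy (\<lambda>n. (?f ^^ n) x)" using Q LIMSEQ_imp_Cauchy by blast
    then show "Cauchy (\<lambda>n. a (G n x))"
      unfolding Cauchy_def dist_norm aG .
  qed
  then obtain f where f: "\<And>x. (\<lambda>n. a (G n x)) \<longlonglongrightarrow> f x"
    unfolding convergent_def by metis
  have norm_f: "inner (f x) (f y) = inner (x - Q x) (y - Q y)" for x y
  proof (rule LIMSEQ_unique)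
    show "(\<lambda>n. inner (a (G n x)) (a (G n y))) \<longlonglongrightarrow> inner (f x) (f y)" by (intro tendsto_intros f)
    show "(\<lambda>n. inner (a (G n x)) (a (G n y))) \<longlonglongrightarrow> inner (x - Q x) (y - Q y)"
      unfolding aP PG by (intro tendsto_intros Q)
  qed
  have ff: "inner (f x) (f y) = inner (x - Q x) y" for x y
    unfolding norm_f by (simp add: inner_diff_left inner_diff_right Q_inner) (simp add: Q_sa[symmetric] QQ)
  have f_le: "norm (f x) \<le> norm x" for x
  proof -
    have "0 \<le> inner (Q x) x" using Q_inner[of x x] by (metis inner_ge_zero)
    then have "(norm (f x))\<^sup>2 \<le> (norm x)\<^sup>2"
      by (simp add: power2_norm_eq_inner ff inner_diff_left)
    then show ?thesis by (simp add: power2_le_iff_abs_le)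
  qed
  have "bounded_linear f"
  proof (rule bounded_linear_intro[of _ 1])
    show "f (x + y) = f x + f y" for x y
      by (rule LIMSEQ_unique[OF f]) (simp add: blinfun.bilinear_simps tendsto_add f)
    show "f (r *\<^sub>R x) = r *\<^sub>R f x" for r x
      by (rule LIMSEQ_unique[OF f]) (simp add: blinfun.bilinear_simps tendsto_scaleR f)
    show "norm (f x) \<le> norm x * 1" for x by (simp add: f_le)
  qed
  then obtain V where Vf: "blinfun_apply V = f"
    using bounded_linear_Blinfun_apply by blast
  have V: "V \<in> bounded_ops"
    by (rule bounded_ops_limit[of "\<lambda>n. a o\<^sub>L G n"]) (simp_all add: bounded_ops_closed a G Vf f)
  show thesis
  proof (rule that)
    show "V \<in> bounded_ops" "P \<in> bounded_ops" "cadjoint P = P" "\<And>n. G n \<in> bounded_ops"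
      by (rule V P P' G)+
    show "norm V \<le> 1" by (rule norm_blinfun_bound) (simp_all add: Vf f_le)
    show "norm (2 *\<^sub>R P - id_blinfun) \<le> 1"
    proof (rule norm_blinfun_bound)
      fix x
      \<comment> \<open>Since $2P - 1 = 1 - 2Y$, this amounts to $Y^2 \le Y$.\<close>
      have "(norm ((2 *\<^sub>R P - id_blinfun) x))\<^sup>2 = inner x x - 4 * inner (Y x) x + 4 * inner (Y x) (Y x)"
        by (simp add: power2_norm_eq_inner blinfun.bilinear_simps Px inner_diff_left inner_diff_right
            inner_commute algebra_simps)
      also have "\<dots> \<le> (norm x)\<^sup>2"
        using pc(1)[of x] by (simp add: power2_norm_eq_inner)
      finally show "norm ((2 *\<^sub>R P - id_blinfun) x) \<le> 1 * norm x"
        by (simp add: power2_le_iff_abs_le)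
    qed simp
    show "cadjoint (G n) = G n" for n by (rule cadjoint_eqI_inner[OF G saG])
    show "(\<lambda>n. a (G n x)) \<longlonglongrightarrow> V x" for x by (simp add: Vf f)
    have CY: "C (Y x) = Y (C x)" if "C \<in> commutant {cadjoint a o\<^sub>L a}" for C x
    proof -
      have "C \<in> commutant {B}"
        using that commutant_singletonD[OF that] commutant_bounded
        by (intro commutantI) (auto simp: Bx blinfun.bilinear_simps)
      then show ?thesis using commutantD[OF Ycom] by simp
    qed
    show "P \<in> commutant (commutant {cadjoint a o\<^sub>L a})"
      by (rule commutantI[OF P]) (simp add: Px CY blinfun.bilinear_simps)
    show "G n \<in> commutant (commutant {cadjoint a o\<^sub>L a})" for n
    proof (rule commutantI[OF G])
      show "G n (C x) = C (G n x)" if "C \<in> commutant {cadjoint a o\<^sub>L a}" for C x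
        by (induction n) (simp_all add: G_def blinfun.bilinear_simps CY[OF that])
    qed
    show "V (cadjoint V (V x)) = V x" for x
    proof -
      have E: "cadjoint V (V x) = x - Q x"
        by (rule inner_ext) (simp only: Vf inner_cadjoint[OF V] ff)
      have "inner (V (Q x)) (V (Q x)) = 0" by (simp add: Vf ff QQ)
      then show ?thesis unfolding E by (simp add: blinfun.bilinear_simps)
    qed
    show "a x = 0 \<longrightarrow> V x = 0" for x
    proof
      assume "a x = 0"
      then have "P x = 0" using nP[of x] by simp
      then have "(?f ^^ n) x = x" for n by (induction n) (simp_all add: Px)
      then have "P (G n x) = 0" for n by (simp add: PG)
      then have "a (G n x) = 0" for n using nP[of "G n x"] by simp
      then have "(\<lambda>n. a (G n x)) \<longlonglongrightarrow> 0" by (simp only: tendsto_const)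
      then have "f x = 0" by (rule LIMSEQ_unique[OF f])
      then show "V x = 0" by (simp add: Vf)
    qed
    show "V (P x) = a x" for x
    proof -
      have eq: "a (G n (P x)) = a x - a ((?f ^^ n) x)" for n
        using PG[of n x] GY[of n x] by (simp add: Px blinfun.bilinear_simps)
      have "(\<lambda>n. norm ((?f ^^ n) x - (?f ^^ Suc n) x)) \<longlonglongrightarrow> norm (Q x - Q x)"
        by (intro tendsto_norm tendsto_diff Q LIMSEQ_Suc[OF Q])
      moreover have "norm (a ((?f ^^ n) x)) = norm ((?f ^^ n) x - (?f ^^ Suc n) x)" for n
        unfolding nP[symmetric] by (simp add: Px)
      ultimately have "(\<lambda>n. a ((?f ^^ n) x)) \<longlonglongrightarrow> 0"
        by (intro tendsto_norm_zero_cancel[of "\<lambda>n. a ((?f ^^ n) x)"])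
          (simp only: diff_self norm_zero)
      then have "(\<lambda>n. a (G n (P x))) \<longlonglongrightarrow> a x - 0"
        unfolding eq by (intro tendsto_diff tendsto_const)
      then have "f (P x) = a x - 0" by (rule LIMSEQ_unique[OF f])
      then show ?thesis by (simp add: Vf)
    qed
  qed
qed

section \<open>Intertwiners of automorphisms of a singular MASA\<close>

text \<open>
  A singular MASA $N$ of $M$ with a *-automorphism $\theta$ of $N$, whose inverse is $\eta$. Both
  maps are total functions on operators, and only their values on $N$ matter.
\<close>

locale singular_masa_automorphism =
  fixes M N :: "('h::chilbert_space \<Rightarrow>\<^sub>L 'h) set"
    and \<theta> \<eta> :: "('h \<Rightarrow>\<^sub>L 'h) \<Rightarrow> ('h \<Rightarrow>\<^sub>L 'h)"
  assumes masa: "masa N M" and sing: "singular_in N M"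
    and \<theta>_in: "n \<in> N \<Longrightarrow> \<theta> n \<in> N" and \<eta>_in: "n \<in> N \<Longrightarrow> \<eta> n \<in> N"
    and \<theta>_\<eta>: "n \<in> N \<Longrightarrow> \<theta> (\<eta> n) = n" and \<eta>_\<theta>: "n \<in> N \<Longrightarrow> \<eta> (\<theta> n) = n"
    and \<theta>_id: "\<theta> id_blinfun = id_blinfun"
    and \<theta>_compose: "m \<in> N \<Longrightarrow> n \<in> N \<Longrightarrow> \<theta> (m o\<^sub>L n) = \<theta> m o\<^sub>L \<theta> n"
    and \<theta>_diff: "m \<in> N \<Longrightarrow> n \<in> N \<Longrightarrow> \<theta> (m - n) = \<theta> m - \<theta> n"
    and \<theta>_cadjoint: "n \<in> N \<Longrightarrow> \<theta> (cadjoint n) = cadjoint (\<theta> n)"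
begin

lemma N: "von_neumann_algebra N" and M: "von_neumann_algebra M"
  and NM: "N \<subseteq> M"
  using masa by (auto simp: masa_def vn_subalgebra_def)

lemma N_commute: "m \<in> N \<Longrightarrow> n \<in> N \<Longrightarrow> blinfun_apply m (n x) = n (m x)"
  using masa unfolding masa_def abelian_def by (metis blinfun_apply_blinfun_compose)

text \<open>The elements $a$ of $M$ with $an = \theta(n)a$ for all $n \in N$.\<close>

definition intertwiner :: "('h \<Rightarrow>\<^sub>L 'h) \<Rightarrow> bool" where
  "intertwiner a \<longleftrightarrow> a \<in> M \<and> (\<forall>(n :: 'h \<Rightarrow>\<^sub>L 'h) x. n \<in> N \<longrightarrow> a (n x) = \<theta> n (a x))"

lemma intertwinerD: "intertwiner a \<Longrightarrow> n \<in> N \<Longrightarrow> blinfun_apply a (blinfun_apply n x) = \<theta> n (a x)"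
  and intertwiner_bounded: "intertwiner a \<Longrightarrow> a \<in> bounded_ops"
  using vn_bounded[OF M] by (auto simp: intertwiner_def)

lemma intertwiner_cadjoint:
  assumes "intertwiner a" "n \<in> N"
  shows "cadjoint a (\<theta> n x) = n (cadjoint a x)"
proof (rule cinner_ext)
  note a = intertwiner_bounded[OF assms(1)]
  note n = vn_bounded[OF N assms(2)] vn_bounded[OF N \<theta>_in[OF assms(2)]]
  show "cinner (cadjoint a (\<theta> n x)) y = cinner (n (cadjoint a x)) y" for y
  proof -
    have "cinner (cadjoint a (\<theta> n x)) y = cinner x (\<theta> (cadjoint n) (a y))"
      by (simp add: cinner_cadjoint[OF a] cinner_cadjoint_right[OF n(2)] \<theta>_cadjoint assms(2))
    also have "\<dots> = cinner x (a (cadjoint n y))"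
      by (simp add: intertwinerD[OF assms(1) vn_cadjoint[OF N assms(2)]])
    also have "\<dots> = cinner (n (cadjoint a x)) y"
      by (metis cinner_cadjoint[OF a] cinner_cadjoint_right[OF n(1)])
    finally show ?thesis .
  qed
qed

lemma intertwiner_cadjoint_inverse:
  assumes "intertwiner a" "n \<in> N"
  shows "cadjoint a (n x) = \<eta> n (cadjoint a x)"
  using intertwiner_cadjoint[OF assms(1) \<eta>_in[OF assms(2)], of x] by (simp add: \<theta>_\<eta> assms(2))

lemma unitary_normalizer_in_N:
  fixes S :: "'h \<Rightarrow>\<^sub>L 'h"
  assumes "S \<in> M" "cadjoint S = S" and SS: "\<And>x. S (S x) = x"
    and norm: "\<And>n. n \<in> N \<Longrightarrow> S o\<^sub>L n o\<^sub>L S \<in> N"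
  shows "S \<in> N"
proof -
  have "S o\<^sub>L S = id_blinfun" by (rule blinfun_eqI) (simp add: SS)
  then have "unitary S"
    using assms(2) vn_bounded[OF M assms(1)] by (simp add: unitary_def)
  moreover have "(\<lambda>T. S o\<^sub>L T o\<^sub>L S) ` N = N"
  proof (intro equalityI subsetI)
    fix n assume "n \<in> N"
    then have "S o\<^sub>L n o\<^sub>L S \<in> N" by (rule norm)
    moreover have "n = S o\<^sub>L (S o\<^sub>L n o\<^sub>L S) o\<^sub>L S" by (rule blinfun_eqI) (simp add: SS)
    ultimately show "n \<in> (\<lambda>T. S o\<^sub>L T o\<^sub>L S) ` N" by (rule rev_image_eqI)
  qed (auto intro: norm)
  ultimately show ?thesis
    using sing assms(1,2) by (simp add: singular_in_def)
qed

text \<open>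
  The point where singularity enters. The initial projection $V^*V$ and the final projection $VV^*$
  of $V$ are orthogonal, so $S = V + V^* + (1 - V^*V - VV^*)$, which exchanges them, is a
  self-adjoint unitary. It normalizes $N$, hence lies in $N$ and commutes with $V^*V \in N$. But
  $SV^*V = V$ and $V^*VS = V^*$, so $V = V^*$ and $V = VV^*V = V^3 = 0$.
\<close>

lemma partial_isometry_intertwiner_square_zero:
  fixes V :: "'h \<Rightarrow>\<^sub>L 'h"
  assumes V: "intertwiner V" and VWV: "\<And>x. V (cadjoint V (V x)) = V x"
    and VV: "\<And>x. V (V x) = 0"
  shows "V x = 0"
proof -
  note Vb = intertwiner_bounded[OF V]
  have VM: "V \<in> M" using V by (simp add: intertwiner_def)
  define W where "W = cadjoint V"
  have WM: "W \<in> M" unfolding W_def by (rule vn_cadjoint[OF M VM])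
  have Wb: "W \<in> bounded_ops" by (rule vn_bounded[OF M WM])
  have W': "cadjoint W = V" unfolding W_def by (rule cadjoint_cadjoint[OF Vb])
  have VWV: "V (W (V x)) = V x" for x using VWV by (simp add: W_def)
  have WW: "W (W x) = 0" for x
    by (rule cinner_ext) (simp add: W_def cinner_cadjoint[OF Vb] VV)
  have WVW: "W (V (W x)) = W x" for x
  proof (rule cinner_ext)
    have "cinner (W (V (W x))) y = cinner x (V (W (V y)))" for y
      unfolding W_def by (simp only: cinner_cadjoint[OF Vb] cinner_cadjoint_right[OF Vb, symmetric])
    then show "cinner (W (V (W x))) y = cinner (W x) y" for y
      by (simp only: VWV) (simp only: W_def cinner_cadjoint[OF Vb])
  qed
  have E: "W o\<^sub>L V \<in> N"
    by (rule masa_contains_relative_commutant[OF masa vn_compose[OF M WM VM]])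
      (simp add: intertwinerD[OF V] intertwiner_cadjoint[OF V] W_def)
  have F: "V o\<^sub>L W \<in> N"
    by (rule masa_contains_relative_commutant[OF masa vn_compose[OF M VM WM]])
      (simp add: intertwinerD[OF V] intertwiner_cadjoint_inverse[OF V] W_def \<eta>_in \<theta>_\<eta>)
  define S where "S = V + W + (id_blinfun - (W o\<^sub>L V) - (V o\<^sub>L W))"
  have S: "S x = V x + W x + (x - W (V x) - V (W x))" for x
    by (simp add: S_def blinfun.bilinear_simps)
  have "S \<in> N"
  proof (rule unitary_normalizer_in_N)
    show "S \<in> M" unfolding S_def using NM E F
      by (intro vn_add[OF M] vn_diff[OF M] VM WM vn_id[OF M]) auto
    show "cadjoint S = S" unfolding S_def
      by (simp add: cadjoint_add cadjoint_diff bounded_ops_closed Vb Wb cadjoint_compose W'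
          cadjoint_id W_def[symmetric] add.commute)
    show "S (S x) = x" for x
      by (simp add: S blinfun.bilinear_simps VV WW VWV WVW)
    show "S o\<^sub>L n o\<^sub>L S \<in> N" if n: "n \<in> N" for n
    proof -
      have En: "W (V (n x)) = n (W (V x))" and Fn: "V (W (n x)) = n (V (W x))" for x
        using N_commute[OF E n] N_commute[OF F n] by simp_all
      have Sn: "S (n x) = \<theta> n (V x) + \<eta> n (W x) + n (x - W (V x) - V (W x))" for x
        unfolding S[of "n x"] En Fn blinfun.diff_right intertwinerD[OF V n]
        by (simp only: W_def intertwiner_cadjoint[OF V n] intertwiner_cadjoint_inverse[OF V n])
      have "S o\<^sub>L n o\<^sub>L S = (\<theta> n o\<^sub>L (V o\<^sub>L W)) + (\<eta> n o\<^sub>L (W o\<^sub>L V))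
          + (n o\<^sub>L (id_blinfun - (W o\<^sub>L V) - (V o\<^sub>L W)))"
      proof (rule blinfun_eqI)
        fix x
        have "V (S x) = V (W x)" "W (S x) = W (V x)"
          "S x - W (V (S x)) - V (W (S x)) = x - W (V x) - V (W x)"
          by (simp_all add: S blinfun.bilinear_simps VV WW VWV WVW)
        then show "(S o\<^sub>L n o\<^sub>L S) x = ((\<theta> n o\<^sub>L (V o\<^sub>L W)) + (\<eta> n o\<^sub>L (W o\<^sub>L V))
          + (n o\<^sub>L (id_blinfun - (W o\<^sub>L V) - (V o\<^sub>L W)))) x"
          by (simp add: Sn blinfun.add_left blinfun.diff_left)
      qed
      also have "\<dots> \<in> N"
        by (intro vn_add[OF N] vn_diff[OF N] vn_compose[OF N E] vn_compose[OF N F]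
            vn_compose[OF N] \<theta>_in \<eta>_in n E F vn_id[OF N])
      finally show ?thesis .
    qed
  qed
  then have "S (W (V x)) = W (V (S x))" for x
    using N_commute[OF _ E, of S x] by simp
  then have "V x = W x" for x
    by (simp add: S blinfun.bilinear_simps VV WW VWV WVW)
  then show "V x = 0" using VWV[of x] VV by metis
qed

text \<open>
  The general case follows by polar decomposition, since the partial isometry inherits the
  intertwining relation and the vanishing square.
\<close>

lemma intertwiner_square_zero:
  fixes a :: "'h \<Rightarrow>\<^sub>L 'h"
  assumes a: "intertwiner a" and aa: "\<And>x. a (a x) = 0"
  shows "a x = 0"
proof -
  \<comment> \<open>The polar decomposition is available for contractions.\<close>
  define b where "b = inverse (norm a + 1) *\<^sub>R a"
  have bx: "b x = inverse (norm a + 1) *\<^sub>R a x" for x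
    by (simp add: b_def blinfun.bilinear_simps)
  have bM: "b \<in> M" using a unfolding b_def intertwiner_def by (simp add: vn_scaleR[OF M])
  have b: "intertwiner b"
    using bM a by (simp add: intertwiner_def bx blinfun.bilinear_simps)
  have bb: "b (b x) = 0" for x by (simp add: bx blinfun.bilinear_simps aa)
  have "0 < norm a + 1" by (simp add: add_nonneg_pos)
  from this have "norm b \<le> 1" by (simp add: b_def divide_simps)
  note polar = polar_decomposition[OF intertwiner_bounded[OF b] this]
  obtain V P :: "'h \<Rightarrow>\<^sub>L 'h" and G :: "nat \<Rightarrow> 'h \<Rightarrow>\<^sub>L 'h" where
    "V \<in> bounded_ops" "norm V \<le> 1" "P \<in> bounded_ops" "cadjoint P = P"
      "norm (2 *\<^sub>R P - id_blinfun) \<le> 1" "\<And>n. G n \<in> bounded_ops" "\<And>n. cadjoint (G n) = G n"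
    and lim: "\<And>x. (\<lambda>n. b (G n x)) \<longlonglongrightarrow> V x"
    and "P \<in> commutant (commutant {cadjoint b o\<^sub>L b})"
    and G: "\<And>n. G n \<in> commutant (commutant {cadjoint b o\<^sub>L b})"
    and VP: "\<And>x. V (P x) = b x" and VWV: "\<And>x. V (cadjoint V (V x)) = V x"
    and ker: "\<And>x. b x = 0 \<longrightarrow> V x = 0"
    by (rule polar) metis
  have bb': "cadjoint b o\<^sub>L b \<in> N"
    by (rule masa_contains_relative_commutant[OF masa vn_compose[OF M vn_cadjoint[OF M bM] bM]])
      (simp add: intertwinerD[OF b] intertwiner_cadjoint[OF b])
  have GN: "G n \<in> N" for n
    using vn_bicommutant_singleton[OF N bb'] G by blast
  have "V \<in> M"
    by (rule vn_limit[OF M, of "\<lambda>n. b o\<^sub>L G n"]) (use GN NM bM lim in \<open>auto intro!: vn_compose[OF M]\<close>)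
  moreover have "V (n x) = \<theta> n (V x)" if n: "n \<in> N" for n x
  proof -
    have "(\<lambda>k. \<theta> n (b (G k x))) \<longlonglongrightarrow> \<theta> n (V x)" by (intro tendsto_intros lim)
    moreover have "\<theta> n (b (G k x)) = b (G k (n x))" for k
      by (simp only: intertwinerD[OF b n, symmetric] N_commute[OF n GN])
    ultimately show ?thesis using LIMSEQ_unique[OF lim] by simp
  qed
  ultimately have "intertwiner V" by (simp add: intertwiner_def)
  moreover have "b (V x) = 0" for x
  proof -
    have "(\<lambda>n. b (b (G n x))) \<longlonglongrightarrow> b (V x)" by (intro tendsto_intros lim)
    then show ?thesis by (simp add: bb LIMSEQ_const_iff)
  qed
  ultimately have "V x = 0" for x
    using partial_isometry_intertwiner_square_zero[OF _ VWV] ker by blast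
  then have "b x = 0" using VP[of x] by simp
  then show ?thesis using \<open>0 < norm a + 1\<close> by (simp add: bx)
qed

text \<open>Here $Wf$ is an intertwiner with $(Wf)^2 = Wf\theta(f)W = 0$.\<close>

lemma intertwiner_vanishes:
  fixes W f :: "'h \<Rightarrow>\<^sub>L 'h"
  assumes W: "intertwiner W" and f: "f \<in> N" "\<And>x. f (\<theta> f x) = 0"
  shows "W (f x) = 0"
proof -
  have "intertwiner (W o\<^sub>L f)"
    using W f NM unfolding intertwiner_def
    by (auto intro!: vn_compose[OF M] simp: N_commute[OF f(1)])
  moreover have "(W o\<^sub>L f) ((W o\<^sub>L f) x) = 0" for x
    by (simp add: intertwinerD[OF W f(1)] f(2) blinfun.zero_right)
  ultimately show ?thesis using intertwiner_square_zero[of "W o\<^sub>L f" x] by simp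
qed

lemma intertwiner_projection:
  fixes W e :: "'h \<Rightarrow>\<^sub>L 'h"
  assumes W: "intertwiner W" and e: "e \<in> N" "\<And>x. e (e x) = e x"
  shows "W (\<theta> e x) = W (e x)"
proof -
  note te = \<theta>_in[OF e(1)]
  have "e o\<^sub>L e = e" by (rule blinfun_eqI) (simp add: e(2))
  then have tt: "\<theta> e (\<theta> e x) = \<theta> e x" for x
    using \<theta>_compose[OF e(1) e(1)] by (metis blinfun_apply_blinfun_compose)
  \<comment> \<open>Both \<open>f\<close> and \<open>g\<close> are projections that are orthogonal to their images under \<open>\<theta>\<close>, so
    \<open>W\<close> annihilates them: $We = We\theta(e)$ and $W\theta(e) = We\theta(e)$.\<close>
  define f where "f = e o\<^sub>L (id_blinfun - \<theta> e)"
  define g where "g = (id_blinfun - e) o\<^sub>L \<theta> e"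
  have fg: "f \<in> N" "g \<in> N" unfolding f_def g_def
    by (intro vn_compose[OF N] vn_diff[OF N] vn_id[OF N] e te)+
  have "\<theta> f = \<theta> e o\<^sub>L (id_blinfun - \<theta> (\<theta> e))" "\<theta> g = (id_blinfun - \<theta> e) o\<^sub>L \<theta> (\<theta> e)"
    unfolding f_def g_def by (simp_all add: \<theta>_compose \<theta>_diff \<theta>_id e te vn_diff[OF N] vn_id[OF N])
  then have "f (\<theta> f x) = 0" "g (\<theta> g x) = 0" for x
    by (simp_all add: f_def g_def blinfun.bilinear_simps tt)
  then have "W (f x) = 0" "W (g x) = 0"
    by (auto intro!: intertwiner_vanishes[OF W] fg)
  then show ?thesis by (simp add: f_def g_def blinfun.bilinear_simps)
qed

text \<open>
  Applied to the projection $\eta(e)$, the previous lemma gives $We = W\eta(e) = eW$.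
\<close>

lemma intertwiner_commutes_projection:
  fixes W e :: "'h \<Rightarrow>\<^sub>L 'h"
  assumes W: "intertwiner W" and e: "e \<in> N" "\<And>x. e (e x) = e x"
  shows "W (e x) = e (W x)"
proof -
  have "e o\<^sub>L e = e" by (rule blinfun_eqI) (simp add: e(2))
  then have "\<theta> (\<eta> e o\<^sub>L \<eta> e) = \<theta> (\<eta> e)"
    by (simp add: \<theta>_compose \<eta>_in e \<theta>_\<eta>)
  then have "\<eta> e o\<^sub>L \<eta> e = \<eta> e"
    by (metis \<eta>_\<theta> \<eta>_in e(1) vn_compose[OF N])
  then have "\<eta> e (\<eta> e x) = \<eta> e x" for x by (metis blinfun_apply_blinfun_compose)
  from intertwiner_projection[OF W \<eta>_in[OF e(1)] this, of x]
  show ?thesis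
    by (simp add: \<theta>_\<eta> e(1) intertwinerD[OF W \<eta>_in[OF e(1)]])
qed

text \<open>
  A self-adjoint contraction $n \in N$ is $s(1 + d)/2$, where $s$ is its sign and
  $d = 2|n| - 1$ is again a self-adjoint contraction in $N$. Iterating this approximates $n$ by
  combinations of products of signs, and thereby replaces spectral projections.
\<close>

lemma sign_decomposition:
  fixes n :: "'h \<Rightarrow>\<^sub>L 'h"
  assumes n: "n \<in> N" "cadjoint n = n" "norm n \<le> 1"
  obtains s d :: "'h \<Rightarrow>\<^sub>L 'h" where "s \<in> N" "\<And>x. s (s (s x)) = s x" "norm s \<le> 1"
    "d \<in> N" "cadjoint d = d" "norm d \<le> 1" "\<And>x. 2 *\<^sub>R n x = s (x + d x)"
proof -
  note nb = vn_bounded[OF N n(1)]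
  obtain s P :: "'h \<Rightarrow>\<^sub>L 'h" and G :: "nat \<Rightarrow> 'h \<Rightarrow>\<^sub>L 'h" where
    s: "s \<in> bounded_ops" "norm s \<le> 1"
    and P: "P \<in> bounded_ops" "cadjoint P = P" "norm (2 *\<^sub>R P - id_blinfun) \<le> 1"
    and G: "\<And>k. G k \<in> bounded_ops" "\<And>k. cadjoint (G k) = G k"
    and lim: "\<And>x. (\<lambda>k. n (G k x)) \<longlonglongrightarrow> s x"
    and PG: "P \<in> commutant (commutant {cadjoint n o\<^sub>L n})"
      "\<And>k. G k \<in> commutant (commutant {cadjoint n o\<^sub>L n})"
    and sP: "\<And>x. s (P x) = n x" and sss: "\<And>x. s (cadjoint s (s x)) = s x"
    and "\<And>x. n x = 0 \<longrightarrow> s x = 0"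
    by (rule polar_decomposition[OF nb n(3)]) metis
  have "cadjoint n o\<^sub>L n \<in> N" by (intro vn_compose[OF N] vn_cadjoint[OF N] n)
  then have PN: "P \<in> N" and GN: "G k \<in> N" for k
    using vn_bicommutant_singleton[OF N] PG by blast+
  have "inner (s x) y = inner x (s y)" for x y
  proof (rule LIMSEQ_unique)
    show "(\<lambda>k. inner (n (G k x)) y) \<longlonglongrightarrow> inner (s x) y" by (intro tendsto_intros lim)
    have "inner (n (G k x)) y = inner x (n (G k y))" for k
    proof -
      have "inner (n (G k x)) y = inner x (G k (n y))"
        by (simp only: self_adjoint_inner[OF nb n(2)] self_adjoint_inner[OF G])
      also have "G k (n y) = n (G k y)" by (rule N_commute[OF GN n(1)])
      finally show ?thesis .
    qed
    then show "(\<lambda>k. inner (n (G k x)) y) \<longlonglongrightarrow> inner x (s y)"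
      by (simp only: tendsto_inner[OF tendsto_const lim])
  qed
  then have s': "cadjoint s = s" by (rule cadjoint_eqI_inner[OF s(1)])
  have sN: "s \<in> N"
    by (rule vn_limit[OF N, of "\<lambda>k. n o\<^sub>L G k"]) (use GN n lim in \<open>auto intro!: vn_compose[OF N]\<close>)
  show thesis
  proof (rule that[of s "2 *\<^sub>R P - id_blinfun"])
    show "2 *\<^sub>R P - id_blinfun \<in> N" by (intro vn_diff[OF N] vn_scaleR[OF N] vn_id[OF N] PN)
    show "cadjoint (2 *\<^sub>R P - id_blinfun) = 2 *\<^sub>R P - id_blinfun"
      by (simp add: cadjoint_diff cadjoint_scaleR bounded_ops_closed P cadjoint_id)
    show "2 *\<^sub>R n x = s (x + (2 *\<^sub>R P - id_blinfun) x)" for x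
      by (simp add: blinfun.bilinear_simps sP)
  qed (use sN s P sss s' in simp_all)
qed

text \<open>
  A sign $s$ is the difference of the projections $(s^2+s)/2$ and $(s^2-s)/2$, so $W$ commutes with
  it. Hence the commutator of $W$ with $n = s(1+d)/2$ is half of $s$ times the commutator with $d$,
  and the norms of commutators with self-adjoint contractions are at most $2\|W\|2^{-k}$ for all $k$.
\<close>

lemma intertwiner_commutes_self_adjoint_contraction:
  fixes W n :: "'h \<Rightarrow>\<^sub>L 'h"
  assumes W: "intertwiner W" and n: "n \<in> N" "cadjoint n = n" "norm n \<le> 1"
  shows "W (n x) = n (W x)"
proof -
  have bound: "norm ((W o\<^sub>L n) - (n o\<^sub>L W)) \<le> 2 * norm W * (1/2)^k"
    if "n \<in> N" "cadjoint n = n" "norm n \<le> 1" for k n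
    using that
  proof (induction k arbitrary: n)
    case 0
    have "norm ((W o\<^sub>L n) - (n o\<^sub>L W)) \<le> norm W * norm n + norm n * norm W"
      by (rule order_trans[OF norm_triangle_ineq4 add_mono]) (rule norm_blinfun_compose)+
    also have "\<dots> \<le> 2 * norm W"
      using mult_left_le[OF 0(3), of "norm W"] by (simp add: mult.commute)
    finally show ?case by simp
  next
    case (Suc k)
    from sign_decomposition[OF Suc.prems] obtain s d where s: "s \<in> N" "\<And>x. s (s (s x)) = s x"
      "norm s \<le> 1" and d: "d \<in> N" "cadjoint d = d" "norm d \<le> 1"
      and nsd: "\<And>x. 2 *\<^sub>R n x = s (x + d x)" by metis
    define p where "p = (1/2) *\<^sub>R ((s o\<^sub>L s) + s)"
    define q where "q = (1/2) *\<^sub>R ((s o\<^sub>L s) - s)"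
    have "p \<in> N" "q \<in> N" unfolding p_def q_def
      by (intro vn_scaleR[OF N] vn_add[OF N] vn_diff[OF N] vn_compose[OF N] s)+
    moreover have quarter: "(1/4) *\<^sub>R (u + v + (v + u)) = (1/2) *\<^sub>R (u + v)"
      "(1/4) *\<^sub>R (u - v - (v - u)) = (1/2) *\<^sub>R (u - v)" for u v :: 'h
    proof -
      have "u + v + (v + u) = 2 *\<^sub>R (u + v)" "u - v - (v - u) = 2 *\<^sub>R (u - v)"
        by (simp_all add: scaleR_2)
      then show "(1/4) *\<^sub>R (u + v + (v + u)) = (1/2) *\<^sub>R (u + v)"
        "(1/4) *\<^sub>R (u - v - (v - u)) = (1/2) *\<^sub>R (u - v)"
        by simp_all
    qed
    then have "p (p x) = p x" "q (q x) = q x" for x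
      by (simp_all add: p_def q_def blinfun.bilinear_simps s(2) scaleR_right_distrib[symmetric]
          scaleR_right_diff_distrib[symmetric])
    ultimately have Wpq: "W (p x) = p (W x)" "W (q x) = q (W x)" for x
      by (auto intro!: intertwiner_commutes_projection[OF W])
    have spq: "s x = p x - q x" for x
      by (simp add: p_def q_def blinfun.bilinear_simps scaleR_right_diff_distrib[symmetric])
    have Ws: "W (s x) = s (W x)" for x
      by (simp only: spq blinfun.diff_right Wpq)
    have half: "n x = (1/2) *\<^sub>R s (x + d x)" for x by (simp add: nsd[symmetric])
    have "(W o\<^sub>L n) - (n o\<^sub>L W) = (1/2) *\<^sub>R (s o\<^sub>L ((W o\<^sub>L d) - (d o\<^sub>L W)))"
      by (rule blinfun_eqI)
        (simp add: half blinfun.bilinear_simps Ws scaleR_right_distrib scaleR_right_diff_distrib)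
    then have "norm ((W o\<^sub>L n) - (n o\<^sub>L W)) = norm (s o\<^sub>L ((W o\<^sub>L d) - (d o\<^sub>L W))) / 2"
      by simp
    also have "\<dots> \<le> (norm s * norm ((W o\<^sub>L d) - (d o\<^sub>L W))) / 2"
      by (intro divide_right_mono norm_blinfun_compose) simp
    also have "\<dots> \<le> (1 * (2 * norm W * (1/2)^k)) / 2"
      by (intro divide_right_mono mult_mono s Suc.IH d) simp_all
    finally show ?case by simp
  qed
  have "(\<lambda>k. 2 * norm W * (1/2)^k) \<longlonglongrightarrow> 2 * norm W * 0"
    by (intro tendsto_intros LIMSEQ_power_zero) simp
  then have "norm ((W o\<^sub>L n) - (n o\<^sub>L W)) \<le> 0"
    using LIMSEQ_le_const[of _ "2 * norm W * 0" "norm ((W o\<^sub>L n) - (n o\<^sub>L W))"] bound[OF n] by auto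
  then have "((W o\<^sub>L n) - (n o\<^sub>L W)) x = 0" by simp
  then show ?thesis by (simp add: blinfun.bilinear_simps)
qed

lemma intertwiner_in_N:
  assumes W: "intertwiner W"
  shows "W \<in> N"
proof (rule masa_contains_relative_commutant[OF masa])
  show "W \<in> M" using W by (simp add: intertwiner_def)
  fix n x assume n: "n \<in> N"
  note nb = vn_bounded[OF N n]
  have sa: "W (h x) = h (W x)" if h: "h \<in> N" "cadjoint h = h" for h x
  proof -
    define c where "c = inverse (norm h + 1)"
    have pos: "0 < norm h + 1" by (simp add: add_nonneg_pos)
    then have c: "c \<noteq> 0" by (simp add: c_def)
    have "norm (c *\<^sub>R h) \<le> 1" using pos by (simp add: c_def divide_simps)
    moreover have "cadjoint (c *\<^sub>R h) = c *\<^sub>R h"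
      by (simp add: cadjoint_scaleR vn_bounded[OF N h(1)] h(2))
    ultimately have "W ((c *\<^sub>R h) x) = (c *\<^sub>R h) (W x)"
      by (intro intertwiner_commutes_self_adjoint_contraction[OF W] vn_scaleR[OF N] h)
    then show ?thesis using c by (simp add: blinfun.bilinear_simps)
  qed
  show "W (n x) = n (W x)"
  proof (rule commutes_cartesian[OF intertwiner_bounded[OF W]]; rule sa)
    show "n + cadjoint n \<in> N" "scalar_op \<i> o\<^sub>L (n - cadjoint n) \<in> N"
      by (intro vn_add[OF N] vn_diff[OF N] vn_compose[OF N] vn_scalar_op[OF N] n vn_cadjoint[OF N])+
  qed (rule cartesian_self_adjoint[OF nb])+
qed

end

section \<open>Operator matrices on the Hilbert space tensor product\<close>

lemma tprod_scaleR_left: "(r *\<^sub>R a) \<otimes> b = r *\<^sub>R (a \<otimes> b)"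
  using tprod_scaleC_left[of "complex_of_real r" a b] by (simp add: scaleC_of_real)

lemma tprod_scaleR_right: "a \<otimes> (r *\<^sub>R b) = r *\<^sub>R (a \<otimes> b)"
  using tprod_scaleC_right[of a "complex_of_real r" b] by (simp add: scaleC_of_real)

lemma norm_tprod: "norm (a \<otimes> b) = norm a * norm b"
proof -
  have "complex_of_real ((norm (a \<otimes> b))\<^sup>2) = complex_of_real ((norm a * norm b)\<^sup>2)"
    unfolding cinner_self[symmetric] cinner_tprod by (simp add: cinner_self power_mult_distrib)
  then have "(norm (a \<otimes> b))\<^sup>2 = (norm a * norm b)\<^sup>2" by (simp only: of_real_eq_iff)
  then show ?thesis by (simp add: power2_eq_iff_nonneg)
qed

lemma bounded_linear_tprod_left: "bounded_linear (\<lambda>a. a \<otimes> b)"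
  by (rule bounded_linear_intro[of _ "norm b"])
    (simp_all add: tprod_add_left tprod_scaleR_left norm_tprod)

lemma bounded_linear_tprod_right: "bounded_linear (\<lambda>b. a \<otimes> b)"
  by (rule bounded_linear_intro[of _ "norm a"])
    (simp_all add: tprod_add_right tprod_scaleR_right norm_tprod)

text \<open>The map $a \mapsto a \otimes f$.\<close>

definition ket :: "'k::chilbert_space \<Rightarrow> 'h::chilbert_space \<Rightarrow>\<^sub>L ('h, 'k) htensor" where
  "ket f = Blinfun (\<lambda>a. a \<otimes> f)"

lemma ket_apply [simp]: "ket f a = a \<otimes> f"
  by (simp add: ket_def bounded_linear_Blinfun_apply bounded_linear_tprod_left)

text \<open>
  The coordinate map at $e$, which for $e$ in the fixed orthonormal basis sends $a \otimes b$ to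
  $\langle e, b\rangle a$, and which is zero for all other $e$.
\<close>

definition bra :: "'k::chilbert_space \<Rightarrow> ('h::chilbert_space, 'k) htensor \<Rightarrow>\<^sub>L 'h" where
  "bra e = Blinfun (\<lambda>z. coord z e)"

lemma bra_apply [simp]:
  fixes z :: "('h::chilbert_space, 'k::chilbert_space) htensor"
  shows "bra e z = coord z e"
proof -
  have "bounded_linear (\<lambda>z :: ('h, 'k) htensor. coord z e)"
    by (rule bounded_linear_intro[of _ 1])
      (simp_all add: plus_htensor.rep_eq scaleR_htensor.rep_eq norm_coord_le)
  then show ?thesis by (simp add: bra_def bounded_linear_Blinfun_apply)
qed

lemma coord_tprod_onb:
  "e \<in> onb \<Longrightarrow> f \<in> onb \<Longrightarrow> coord (a \<otimes> f) e = (if e = f then a else 0)"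
  by (simp add: tprod.rep_eq onb_cinner)

text \<open>The entry at $(e, f)$ of the matrix of $T$ with respect to the fixed basis.\<close>

definition op_coef ::
    "(('h::chilbert_space, 'k::chilbert_space) htensor \<Rightarrow>\<^sub>L ('h, 'k) htensor) \<Rightarrow> 'k \<Rightarrow> 'k \<Rightarrow> ('h \<Rightarrow>\<^sub>L 'h)" where
  "op_coef T e f = bra e o\<^sub>L T o\<^sub>L ket f"

lemma op_coef_apply [simp]: "op_coef T e f a = coord (T (a \<otimes> f)) e"
  by (simp add: op_coef_def)

lemma op_coef_bounded: "T \<in> bounded_ops \<Longrightarrow> op_coef T e f \<in> bounded_ops"
  by (simp add: bounded_ops_def tprod_scaleC_left scaleC_htensor.rep_eq)

lemma htensor_op_eqI:
  fixes S T :: "('h::chilbert_space, 'k::chilbert_space) htensor \<Rightarrow>\<^sub>L ('h, 'k) htensor"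
  assumes eq: "\<And>a f. f \<in> onb \<Longrightarrow> S (a \<otimes> f) = T (a \<otimes> f)"
  shows "S = T"
proof -
  have tp: "S (a \<otimes> b) = T (a \<otimes> b)" for a b
  proof -
    have lim: "((\<lambda>e. X ((cinner e b *\<^sub>C a) \<otimes> e)) has_sum X (a \<otimes> b)) onb"
      for X :: "('h, 'k) htensor \<Rightarrow>\<^sub>L ('h, 'k) htensor"
      using has_sum_bounded_linear[OF bounded_linear_compose[OF blinfun.bounded_linear_right
          bounded_linear_tprod_right] onb_expansion, of X a b]
      by (simp add: tprod_scaleC_left tprod_scaleC_right)
    have "((\<lambda>e. S ((cinner e b *\<^sub>C a) \<otimes> e)) has_sum T (a \<otimes> b)) onb"
      using lim[of T] by (simp add: eq cong: has_sum_cong)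
    then show ?thesis by (rule has_sum_unique[OF lim])
  qed
  let ?E = "{z. S z = T z}"
  have "closed ?E"
    by (intro closed_Collect_eq continuous_intros)
  moreover have "span (range (\<lambda>(a, b). a \<otimes> b)) \<subseteq> ?E"
  proof (rule span_minimal)
    show "subspace ?E" by (simp add: subspace_def blinfun.bilinear_simps)
  qed (auto simp: tp)
  ultimately have "?E = UNIV"
    using tprod_total[where 'a='h and 'b='k] closure_minimal by blast
  then show ?thesis by (intro blinfun_eqI) blast
qed

lemma norm_blinfun_power2_le: "(norm (blinfun_apply T x))\<^sup>2 \<le> (norm T)\<^sup>2 * (norm x)\<^sup>2"
  using power_mono[OF norm_blinfun norm_ge_zero, of T x 2] by (simp add: power_mult_distrib)

lift_definition amp_fun ::
    "('h::chilbert_space \<Rightarrow>\<^sub>L 'h) \<Rightarrow> ('h, 'k::chilbert_space) htensor \<Rightarrow> ('h, 'k) htensor"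
  is "\<lambda>c z e. blinfun_apply c (z e)"
proof
  fix c :: "'h \<Rightarrow>\<^sub>L 'h" and z :: "'k \<Rightarrow> 'h"
  assume "(\<forall>e. e \<notin> onb \<longrightarrow> z e = 0) \<and> (\<lambda>e. (norm (z e))\<^sup>2) summable_on UNIV"
  then have z: "\<forall>e. e \<notin> onb \<longrightarrow> z e = 0" "(\<lambda>e. (norm (z e))\<^sup>2) summable_on UNIV" by blast+
  show "\<forall>e. e \<notin> onb \<longrightarrow> c (z e) = 0" using z(1) by simp
  show "(\<lambda>e. (norm (c (z e)))\<^sup>2) summable_on UNIV"
    by (rule summable_on_comparison_test[OF summable_on_cmult_right[OF z(2), of "(norm c)\<^sup>2"]])
      (simp_all add: norm_blinfun_power2_le)
qed

lemma bounded_linear_amp_fun: "bounded_linear (amp_fun c)"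
proof (rule bounded_linear_intro[of _ "norm c"])
  show "amp_fun c (x + y) = amp_fun c x + amp_fun c y" for x y
    by (rule htensor_eqI) (simp add: amp_fun.rep_eq plus_htensor.rep_eq blinfun.add_right)
  show "amp_fun c (r *\<^sub>R x) = r *\<^sub>R amp_fun c x" for r x
    by (rule htensor_eqI) (simp add: amp_fun.rep_eq scaleR_htensor.rep_eq blinfun.scaleR_right)
  show "norm (amp_fun c x) \<le> norm x * norm c" for x
  proof -
    have "(norm (amp_fun c x))\<^sup>2 \<le> (norm c)\<^sup>2 * (norm x)\<^sup>2"
      by (rule has_sum_mono[OF has_sum_norm_htensor has_sum_cmult_right[OF has_sum_norm_htensor]])
        (simp add: amp_fun.rep_eq norm_blinfun_power2_le)
    then have "(norm (amp_fun c x))\<^sup>2 \<le> (norm x * norm c)\<^sup>2"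
      by (simp add: power_mult_distrib mult.commute)
    then show ?thesis by (rule power2_le_imp_le) simp
  qed
qed

text \<open>The amplification $c \otimes 1$.\<close>

definition amp ::
    "('h::chilbert_space \<Rightarrow>\<^sub>L 'h) \<Rightarrow> (('h, 'k::chilbert_space) htensor \<Rightarrow>\<^sub>L ('h, 'k) htensor)" where
  "amp c = Blinfun (amp_fun c)"

lemma coord_amp [simp]: "coord (amp c z) e = c (coord z e)"
  by (simp add: amp_def bounded_linear_Blinfun_apply bounded_linear_amp_fun amp_fun.rep_eq)

lemma amp_tprod: "c \<in> bounded_ops \<Longrightarrow> amp c (a \<otimes> b) = c a \<otimes> b"
  by (rule htensor_eqI) (simp add: tprod.rep_eq bounded_opsD)

lemma amp_bounded: "c \<in> bounded_ops \<Longrightarrow> amp c \<in> bounded_ops"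
  by (auto simp: bounded_ops_def scaleC_htensor.rep_eq intro!: htensor_eqI)

lemma amp_id: "amp id_blinfun = id_blinfun"
  and amp_compose: "amp (c o\<^sub>L d) = amp c o\<^sub>L amp d"
  and amp_diff: "amp (c - d) = amp c - amp d"
  by (rule blinfun_eqI, rule htensor_eqI,
      simp add: blinfun.bilinear_simps minus_htensor.rep_eq)+

lemma cadjoint_amp:
  assumes "c \<in> bounded_ops"
  shows "cadjoint (amp c) = amp (cadjoint c)"
proof (rule cadjoint_eqI[OF amp_bounded[OF assms]])
  show "cinner (amp (cadjoint c) x) y = cinner x (amp c y)" for x y :: "('a, 'b) htensor"
    unfolding cinner_htensor_def by (simp add: cinner_cadjoint[OF assms])
qed

lemma op_coef_amp: "f \<in> onb \<Longrightarrow> op_coef (amp c) f f = c"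
  by (rule blinfun_eqI) (simp add: coord_tprod_onb)

lemma commutes_with_amp:
  assumes c: "c \<in> bounded_ops"
    and comm: "\<And>e f a. e \<in> onb \<Longrightarrow> f \<in> onb \<Longrightarrow> op_coef T e f (c a) = c (op_coef T e f a)"
  shows "T (amp c z) = amp c (T z)"
proof -
  have "T o\<^sub>L amp c = amp c o\<^sub>L T"
  proof (rule htensor_op_eqI, rule htensor_eqI)
    fix a f e assume "f \<in> (onb :: 'b set)"
    then show "coord ((T o\<^sub>L amp c) (a \<otimes> f)) e = coord ((amp c o\<^sub>L T) (a \<otimes> f)) e"
      using comm[of e f a] by (cases "e \<in> onb") (simp_all add: amp_tprod[OF c] coord_outside)
  qed
  then show ?thesis by (metis blinfun_apply_blinfun_compose)
qed

text \<open>
  The operator $n \otimes |f\rangle\langle g|$, for $g$ in the fixed basis.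
\<close>

definition matrix_unit ::
    "'k::chilbert_space \<Rightarrow> 'k \<Rightarrow> ('h::chilbert_space \<Rightarrow>\<^sub>L 'h) \<Rightarrow> (('h, 'k) htensor \<Rightarrow>\<^sub>L ('h, 'k) htensor)" where
  "matrix_unit f g n = ket f o\<^sub>L n o\<^sub>L bra g"

lemma matrix_unit_apply: "matrix_unit f g n z = n (coord z g) \<otimes> f"
  by (simp add: matrix_unit_def)

lemma matrix_unit_is_tensor_op:
  assumes "n \<in> bounded_ops" "g \<in> onb"
  shows "\<exists>y\<in>bounded_ops. is_tensor_op n y (matrix_unit f g n)"
proof
  let ?y = "Blinfun (\<lambda>b. cinner g b *\<^sub>C f)"
  have "bounded_linear (\<lambda>b. cinner g b *\<^sub>C f)"
  proof (rule bounded_linear_intro[of _ "norm g * norm f"])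
    show "norm (cinner g b *\<^sub>C f) \<le> norm b * (norm g * norm f)" for b
      using mult_right_mono[OF norm_cinner_le[of g b] norm_ge_zero[of f]]
      by (simp add: norm_scaleC mult_ac)
  qed (simp_all add: cinner_add_right scaleC_add_left cinner_scaleR_right
      scaleC_scaleC[symmetric] scaleC_of_real)
  then have y: "?y b = cinner g b *\<^sub>C f" for b
    by (simp add: bounded_linear_Blinfun_apply)
  show "?y \<in> bounded_ops"
    by (simp add: bounded_ops_def y cinner_scaleC_right scaleC_scaleC)
  show "is_tensor_op n ?y (matrix_unit f g n)"
    using assms by (simp add: is_tensor_op_def matrix_unit_apply y tprod.rep_eq bounded_opsD
        tprod_scaleC_left tprod_scaleC_right)
qed

text \<open>An operator that commutes with $1 \otimes \mathcal{B}(K)$ is an amplification.\<close>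

lemma commutes_with_matrix_units:
  assumes C: "C \<in> bounded_ops" and g: "g \<in> onb"
    and comm: "\<And>e f z. e \<in> onb \<Longrightarrow> f \<in> onb \<Longrightarrow>
      C (matrix_unit e f id_blinfun z) = matrix_unit e f id_blinfun (C z)"
  shows "C = amp (op_coef C g g)"
proof (rule htensor_op_eqI)
  fix a f assume f: "f \<in> (onb :: 'b set)"
  have "C (a \<otimes> f) = C (matrix_unit f g id_blinfun (a \<otimes> g))"
    using g by (simp add: matrix_unit_apply coord_tprod_onb)
  also have "\<dots> = op_coef C g g a \<otimes> f"
    unfolding comm[OF f g] by (simp add: matrix_unit_apply)
  finally show "C (a \<otimes> f) = amp (op_coef C g g) (a \<otimes> f)"
    by (simp only: amp_tprod[OF op_coef_bounded[OF C]])
qed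

section \<open>The tensor product with all bounded operators\<close>

lemma tensor_op_bounded:
  assumes "x \<in> bounded_ops" "is_tensor_op x y T"
  shows "T \<in> bounded_ops"
  unfolding bounded_ops_def
proof (intro CollectI allI)
  fix c z
  have "T o\<^sub>L scalar_op c = scalar_op c o\<^sub>L T"
    by (rule htensor_op_eqI)
      (use assms in \<open>simp add: is_tensor_op_def bounded_opsD tprod_scaleC_left[symmetric]\<close>)
  then show "T (c *\<^sub>C z) = c *\<^sub>C T z"
    by (metis blinfun_apply_blinfun_compose scalar_op_apply)
qed

text \<open>The von Neumann algebra tensor product of $N$ with $\mathcal{B}(K)$.\<close>

abbreviation vn_amplification ::
    "('h::chilbert_space \<Rightarrow>\<^sub>L 'h) set \<Rightarrow> (('h, 'k::chilbert_space) htensor \<Rightarrow>\<^sub>L ('h, 'k) htensor) set" where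
  "vn_amplification N \<equiv> vn_tensor N bounded_ops"

lemma vn_vn_amplification:
  assumes "N \<subseteq> bounded_ops"
  shows "von_neumann_algebra (vn_amplification N)"
  unfolding vn_tensor_def
  by (rule vn_vn_generated) (use assms tensor_op_bounded in blast)

lemma vn_amplification_mono: "N \<subseteq> M \<Longrightarrow> vn_amplification N \<subseteq> vn_amplification M"
  unfolding vn_tensor_def vn_generated_def by blast

lemma tensor_op_in_vn_amplification:
  "x \<in> N \<Longrightarrow> y \<in> bounded_ops \<Longrightarrow> is_tensor_op x y T \<Longrightarrow> T \<in> vn_amplification N"
  unfolding vn_tensor_def vn_generated_def by blast

lemma amp_in_vn_amplification:
  assumes "N \<subseteq> bounded_ops" "n \<in> N"
  shows "amp n \<in> vn_amplification N"
  by (rule tensor_op_in_vn_amplification[OF assms(2) bounded_ops_id])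
    (use assms in \<open>auto simp: is_tensor_op_def amp_tprod\<close>)

lemma matrix_unit_in_vn_amplification:
  assumes "N \<subseteq> bounded_ops" "n \<in> N" "g \<in> onb"
  shows "matrix_unit f g n \<in> vn_amplification N"
  using matrix_unit_is_tensor_op[of n g f] assms tensor_op_in_vn_amplification by blast

text \<open>
  Elements of $M \mathbin{\bar\otimes} \mathcal{B}(K)$ commute with $M' \otimes 1$, so their
  matrix entries commute with $M'$.
\<close>

lemma op_coef_in:
  assumes M: "von_neumann_algebra M" and T: "T \<in> vn_amplification M"
  shows "op_coef T e f \<in> M"
proof -
  have Mb: "M \<subseteq> bounded_ops" using vn_bounded[OF M] by blast
  have vM': "von_neumann_algebra (commutant M)"
    by (rule vn_commutant[OF Mb vn_cadjoint[OF M]])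
  let ?A = "amp ` commutant M :: (('a, 'b) htensor \<Rightarrow>\<^sub>L ('a, 'b) htensor) set"
  have cb: "c \<in> bounded_ops" if "c \<in> commutant M" for c
    using that commutant_bounded by blast
  have "von_neumann_algebra (commutant ?A)"
    by (rule vn_commutant) (auto simp: amp_bounded cb cadjoint_amp vn_cadjoint[OF vM'])
  moreover have "S \<in> commutant ?A" if x: "x \<in> M" and S: "is_tensor_op x y S" for x y S
  proof (rule commutantI)
    show "S \<in> bounded_ops" using tensor_op_bounded S vn_bounded[OF M x] by blast
    fix C z assume "C \<in> ?A"
    then obtain c where c: "C = amp c" "c \<in> commutant M" by blast
    have "S o\<^sub>L amp c = amp c o\<^sub>L S"
      by (rule htensor_op_eqI)
        (use S commutantD[OF c(2) x] in \<open>simp add: is_tensor_op_def amp_tprod cb c(2)\<close>)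
    then show "S (C z) = C (S z)" unfolding c by (metis blinfun_apply_blinfun_compose)
  qed
  ultimately have "vn_amplification M \<subseteq> commutant ?A"
    unfolding vn_tensor_def vn_generated_def by blast
  with T have TA: "T \<in> commutant ?A" by blast
  show ?thesis
  proof (rule vn_memI[OF M op_coef_bounded])
    show "T \<in> bounded_ops" using TA commutant_bounded by blast
    fix c a assume c: "c \<in> commutant M"
    have "T (amp c (a \<otimes> f)) = amp c (T (a \<otimes> f))" using c by (intro commutantD[OF TA]) simp
    then show "op_coef T e f (c a) = c (op_coef T e f a)" by (simp add: amp_tprod cb c)
  qed
qed

text \<open>
  Conversely, everything that commutes with $N \mathbin{\bar\otimes} \mathcal{B}(K)$ is of the
  form $c \otimes 1$ with $c \in N'$, and such an operator commutes with every $T$ whose matrix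
  entries are in $N$.
\<close>

lemma in_vn_amplificationI:
  fixes T :: "('h::chilbert_space, 'k::chilbert_space) htensor \<Rightarrow>\<^sub>L ('h, 'k) htensor"
  assumes N: "von_neumann_algebra N" and T: "T \<in> bounded_ops"
    and coef: "\<And>e f. e \<in> onb \<Longrightarrow> f \<in> onb \<Longrightarrow> op_coef T e f \<in> N"
  shows "T \<in> vn_amplification N"
proof -
  have Nb: "N \<subseteq> bounded_ops" using vn_bounded[OF N] by blast
  show ?thesis
  proof (rule vn_memI[OF vn_vn_amplification[OF Nb] T])
    fix C :: "('h, 'k) htensor \<Rightarrow>\<^sub>L ('h, 'k) htensor" and z
    assume C: "C \<in> commutant (vn_amplification N)"
    then have Cb: "C \<in> bounded_ops" using commutant_bounded by blast
    show "T (C z) = C (T z)"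
    proof (cases "(onb :: 'k set) = {}")
      \<comment> \<open>Without basis vectors both spaces \<open>K\<close> and $H \otimes K$ are zero.\<close>
      case True
      then have "T o\<^sub>L C = C o\<^sub>L T" by (intro htensor_op_eqI) simp
      then show ?thesis by (metis blinfun_apply_blinfun_compose)
    next
      case False
      then obtain g :: 'k where g: "g \<in> onb" by blast
      let ?c = "op_coef C g g"
      have cb: "?c \<in> bounded_ops" by (rule op_coef_bounded[OF Cb])
      have comm: "C (matrix_unit e f n z) = matrix_unit e f n (C z)"
        if "n \<in> N" "e \<in> onb" "f \<in> onb" for e f n z
        by (rule commutantD[OF C matrix_unit_in_vn_amplification[OF Nb]]) (use that in auto)
      have Camp: "C = amp ?c"
        by (rule commutes_with_matrix_units[OF Cb g comm[OF vn_id[OF N]]])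
      have cn: "?c (n a) = n (?c a)" if "n \<in> N" for n a
        using arg_cong[OF comm[OF that g g, of "a \<otimes> g"], of "\<lambda>z. coord z g"] g
        by (simp add: matrix_unit_apply coord_tprod_onb)
      have "T (amp ?c z) = amp ?c (T z)"
        by (rule commutes_with_amp[OF cb cn[OF coef, symmetric]])
      then show ?thesis using Camp by simp
    qed
  qed
qed

section \<open>Unitaries normalizing the amplification\<close>

text \<open>
  If $N$ is abelian, then $N \otimes 1$ is the centre of $N \mathbin{\bar\otimes} \mathcal{B}(K)$,
  so conjugation by a normalizing unitary maps it into itself. The element $n'$ with
  $U(n \otimes 1)U^* = n' \otimes 1$ is recovered as a diagonal matrix entry.
\<close>

lemma normalizer_induces_map:
  fixes U :: "('h::chilbert_space, 'k::chilbert_space) htensor \<Rightarrow>\<^sub>L ('h, 'k) htensor"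
  assumes N: "von_neumann_algebra N" and ab: "abelian N" and g: "g \<in> onb"
    and U: "\<And>z. cadjoint U (U z) = z"
    and norm: "(\<lambda>T. U o\<^sub>L T o\<^sub>L cadjoint U) ` vn_amplification N = vn_amplification N"
    and n: "n \<in> N"
  shows "op_coef (U o\<^sub>L amp n o\<^sub>L cadjoint U) g g \<in> N"
    and "U o\<^sub>L amp n o\<^sub>L cadjoint U = amp (op_coef (U o\<^sub>L amp n o\<^sub>L cadjoint U) g g)"
proof -
  have Nb: "N \<subseteq> bounded_ops" using vn_bounded[OF N] by blast
  let ?Z = "U o\<^sub>L amp n o\<^sub>L cadjoint U"
  have "amp n \<in> vn_amplification N" by (rule amp_in_vn_amplification[OF Nb n])
  then have Z: "?Z \<in> vn_amplification N" using norm by blast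
  then show "op_coef ?Z g g \<in> N" by (rule op_coef_in[OF N])
  have central: "amp n (T z) = T (amp n z)" if "T \<in> vn_amplification N"
    for T :: "('h, 'k) htensor \<Rightarrow>\<^sub>L ('h, 'k) htensor" and z
  proof (rule commutes_with_amp[symmetric])
    show "n \<in> bounded_ops" using n Nb by blast
    show "op_coef T e f (n a) = n (op_coef T e f a)" for e f a
      using op_coef_in[OF N that, of e f] ab n unfolding abelian_def
      by (metis blinfun_apply_blinfun_compose)
  qed
  show "?Z = amp (op_coef ?Z g g)"
  proof (rule commutes_with_matrix_units[OF _ g])
    show "?Z \<in> bounded_ops" using vn_bounded[OF vn_vn_amplification[OF Nb] Z] .
    fix e f :: 'k and z assume "e \<in> onb" "f \<in> onb"
    then have "matrix_unit e f id_blinfun \<in> vn_amplification N"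
      by (intro matrix_unit_in_vn_amplification[OF Nb vn_id[OF N]])
    then obtain T where T: "T \<in> vn_amplification N"
      "matrix_unit e f id_blinfun = U o\<^sub>L T o\<^sub>L cadjoint U"
      using norm by blast
    show "?Z (matrix_unit e f id_blinfun z) = matrix_unit e f id_blinfun (?Z z)"
      unfolding T(2) by (simp add: U central[OF T(1)])
  qed
qed

theorem corollary2p6:
  fixes M N :: "('h::chilbert_space \<Rightarrow>\<^sub>L 'h) set"
  assumes "von_neumann_algebra M"
    and "masa N M"
    and "singular_in N M"
  shows "completely_singular TYPE('k::chilbert_space) N M"
  unfolding completely_singular_def singular_in_def vn_subalgebra_def
proof (intro conjI ballI impI)
  have N: "von_neumann_algebra N" and NM: "N \<subseteq> M" and ab: "abelian N"
    using assms(2) by (auto simp: masa_def vn_subalgebra_def)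
  note M = assms(1)
  have Nb: "N \<subseteq> bounded_ops" and Mb: "M \<subseteq> bounded_ops"
    using vn_bounded M N by blast+
  let ?N = "vn_amplification N :: (('h, 'k) htensor \<Rightarrow>\<^sub>L ('h, 'k) htensor) set"
  let ?M = "vn_amplification M :: (('h, 'k) htensor \<Rightarrow>\<^sub>L ('h, 'k) htensor) set"
  show "von_neumann_algebra ?N" "von_neumann_algebra ?M" "?N \<subseteq> ?M"
    by (rule vn_vn_amplification[OF Nb] vn_vn_amplification[OF Mb] vn_amplification_mono[OF NM])+
  fix U :: "('h, 'k) htensor \<Rightarrow>\<^sub>L ('h, 'k) htensor"
  assume UM: "U \<in> ?M" and "unitary U \<and> (\<lambda>T. U o\<^sub>L T o\<^sub>L cadjoint U) ` ?N = ?N"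
  then have Ub: "U \<in> bounded_ops"
    and comp: "cadjoint U o\<^sub>L U = id_blinfun" "U o\<^sub>L cadjoint U = id_blinfun"
    and norm: "(\<lambda>T. U o\<^sub>L T o\<^sub>L cadjoint U) ` ?N = ?N"
    by (auto simp: unitary_def)
  have U1: "cadjoint U (U z) = z" and U2: "U (cadjoint U z) = z" for z
    using arg_cong[OF comp(1), of "\<lambda>T. blinfun_apply T z"]
      arg_cong[OF comp(2), of "\<lambda>T. blinfun_apply T z"] by simp_all
  have U'b: "cadjoint U \<in> bounded_ops" and U'': "cadjoint (cadjoint U) = U"
    by (rule cadjoint_in_bounded_ops[OF Ub], rule cadjoint_cadjoint[OF Ub])
  have norm': "(\<lambda>T. cadjoint U o\<^sub>L T o\<^sub>L cadjoint (cadjoint U)) ` ?N = ?N"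
  proof -
    have inv: "cadjoint U o\<^sub>L (U o\<^sub>L T o\<^sub>L cadjoint U) o\<^sub>L U = T" for T
      by (rule blinfun_eqI) (simp add: U1)
    have "(\<lambda>T. cadjoint U o\<^sub>L T o\<^sub>L U) ` ((\<lambda>T. U o\<^sub>L T o\<^sub>L cadjoint U) ` ?N) = ?N"
      by (simp add: image_image inv)
    then show ?thesis by (simp only: norm U'')
  qed
  show "U \<in> ?N"
  proof (rule in_vn_amplificationI[OF N Ub])
    fix e f :: 'k assume e: "e \<in> onb" and f: "f \<in> onb"
    define \<theta> where "\<theta> n = op_coef (U o\<^sub>L amp n o\<^sub>L cadjoint U) f f" for n
    define \<eta> where "\<eta> n = op_coef (cadjoint U o\<^sub>L amp n o\<^sub>L U) f f" for n
    note ind = normalizer_induces_map[OF N ab f U1 norm]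
    note ind' = normalizer_induces_map[OF N ab f _ norm', unfolded U'', OF U2]
    have \<theta>: "\<theta> n \<in> N" "amp (\<theta> n) = U o\<^sub>L amp n o\<^sub>L cadjoint U" if "n \<in> N" for n
      unfolding \<theta>_def by (rule ind(1)[OF that], rule ind(2)[OF that, symmetric])
    have \<eta>: "\<eta> n \<in> N" "amp (\<eta> n) = cadjoint U o\<^sub>L amp n o\<^sub>L U" if "n \<in> N" for n
      unfolding \<eta>_def by (rule ind'(1)[OF that], rule ind'(2)[OF that, symmetric])
    have amp_inj: "c = d" if "amp c = (amp d :: ('h, 'k) htensor \<Rightarrow>\<^sub>L ('h, 'k) htensor)" for c d
    proof -
      have "c = op_coef (amp c) f f" by (rule op_coef_amp[OF f, symmetric])
      also have "\<dots> = d" unfolding that by (rule op_coef_amp[OF f])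
      finally show ?thesis .
    qed
    interpret singular_masa_automorphism M N \<theta> \<eta>
    proof
      show "masa N M" "singular_in N M" by (rule assms)+
      show "\<theta> n \<in> N" "\<eta> n \<in> N" if "n \<in> N" for n by (rule \<theta>(1) \<eta>(1), rule that)+
      show "\<theta> (\<eta> n) = n" if "n \<in> N" for n
        by (rule amp_inj, rule blinfun_eqI) (simp add: \<theta>(2) \<eta> that U2)
      show "\<eta> (\<theta> n) = n" if "n \<in> N" for n
        by (rule amp_inj, rule blinfun_eqI) (simp add: \<eta>(2) \<theta> that U1)
      show "\<theta> id_blinfun = id_blinfun"
        by (rule amp_inj, rule blinfun_eqI) (simp add: \<theta>(2) vn_id[OF N] amp_id U2)
      show "\<theta> (m o\<^sub>L n) = \<theta> m o\<^sub>L \<theta> n" if "m \<in> N" "n \<in> N" for m n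
        by (rule amp_inj, rule blinfun_eqI)
          (simp add: \<theta>(2) vn_compose[OF N] that amp_compose U1)
      show "\<theta> (m - n) = \<theta> m - \<theta> n" if "m \<in> N" "n \<in> N" for m n
        by (rule amp_inj, rule blinfun_eqI)
          (simp add: \<theta>(2) vn_diff[OF N] that amp_diff blinfun.bilinear_simps)
      show "\<theta> (cadjoint n) = cadjoint (\<theta> n)" if n: "n \<in> N" for n
      proof (rule amp_inj)
        have nb: "n \<in> bounded_ops" "\<theta> n \<in> bounded_ops" using n \<theta>(1)[OF n] Nb by blast+
        have "amp (\<theta> (cadjoint n)) = U o\<^sub>L cadjoint (amp n) o\<^sub>L cadjoint U"
          by (simp only: \<theta>(2)[OF vn_cadjoint[OF N n]] cadjoint_amp[OF nb(1)])
        also have "\<dots> = cadjoint (U o\<^sub>L amp n o\<^sub>L cadjoint U)"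
          by (rule blinfun_eqI)
            (simp add: cadjoint_compose bounded_ops_compose amp_bounded nb Ub U'b U'')
        also have "\<dots> = amp (cadjoint (\<theta> n))"
          by (simp only: \<theta>(2)[OF n, symmetric] cadjoint_amp[OF nb(2)])
        finally show "amp (\<theta> (cadjoint n)) = (amp (cadjoint (\<theta> n)) :: ('h, 'k) htensor \<Rightarrow>\<^sub>L ('h, 'k) htensor)" .
      qed
    qed
    have "op_coef U e f (n a) = \<theta> n (op_coef U e f a)" if n: "n \<in> N" for n a
    proof -
      have "U (amp n (a \<otimes> f)) = amp (\<theta> n) (U (a \<otimes> f))"
        by (simp add: \<theta>(2)[OF n] U1)
      moreover have "n \<in> bounded_ops" using n Nb by blast
      ultimately show ?thesis by (simp add: amp_tprod)
    qed
    then have "intertwiner (op_coef U e f)"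
      using op_coef_in[OF M UM, of e f] unfolding intertwiner_def by blast
    then show "op_coef U e f \<in> N" by (rule intertwiner_in_N)
  qed
qed

end
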